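(* Let $(\alpha_n)_{n\in\mathbb N}$, $(\beta_n)_{n\in\mathbb N}$ be real sequences in $[-1,1]$ with $\alpha_n^2+\beta_n^2=1$ for all $n\in\mathbb N$, $\alpha_0=1$, and $\beta_n\neq 0$ for all $n\ge 1$. For a state $\psi$ on $M_2(\mathbb C)$ let $T_\psi$ be the associated transition operator on $\mathcal B(\mathcal H)$, $\mathcal H=\ell^2(\mathbb N)$. Then: 1. Let $\psi\neq\psi_+$ be a state on $M_2(\mathbb C)$. Then $T_\psi$ is an extreme point of the convex set $\mathrm{UCP}(\mathcal H)$ if and only if $\psi$ is pure. 2. If $\psi=\psi_+$, then the following statements are equivalent: (a) $T_{\psi_+}$ is not an extreme point of $\mathrm{UCP}(\mathcal H)$. (b) $s^*a^2s$ is a non-zero scalar multiple of $\mathbf 1$ or a non-zero scalar multiple of $p_0$.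
   Context: $\mathbb N$ includes $0$. $\mathcal H=\ell^2(\mathbb N)$ has canonical orthonormal basis $(e_n)_{n\in\mathbb N}$; scalar products are linear in the first component; $\mathbf 1$ is the identity operator; $p_0$ is the orthogonal projection onto $\mathbb C e_0$. Let $a,b\in\mathcal B(\mathcal H)$ be the diagonal operators $a e_n=\alpha_n e_n$, $b e_n=\beta_n e_n$, and let $s$ be the isometric shift $s e_n=e_{n+1}$. Writing operators on $\mathcal H\otimes\mathbb C^2$ as $2\times2$ matrices with entries in $\mathcal B(\mathcal H)$ (so $x\otimes y=(y_{i,j}x)_{i,j}$), define the unitary $$u=\begin{pmatrix} s^*as & i s^*b\\ i bs & a\end{pmatrix}.$$ For a state $\psi$ on $M_2=M_2(\mathbb C)$ let $P_\psi:\mathcal B(\mathcal H\otimes\mathbb C^2)\to\mathcal B(\mathcal H)$ be the linear extension of $P_\psi(x\otimes y)=\psi(y)x$. The transition operator associated with $\psi$ is $T_\psi(x)=P_\psi\bigl(u^*(x\otimes\mathbf 1)u\bigr)$, $x\in\mathcal B(\mathcal H)$. $\psi_+$ is the state $\psi_+(y)=y_{1,1}$ on $M_2$ (the upper-left entry). A state on $M_2$ is pure if it is an extreme point of the convex set of states (equivalently, a vector state). $\mathrm{UCP}(\mathcal H)$ is the convex set of all unital completely positive normal linear maps $\mathcal B(\mathcal H)\to\mathcal B(\mathcal H)$. *)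

theory Defs
  imports "HOL-Analysis.Analysis" "HOL-Library.Function_Algebras"
begin

section \<open>Complex vector spaces\<close>

class scaleC =
  fixes scaleC :: "complex \<Rightarrow> 'a \<Rightarrow> 'a"  (infixr \<open>*\<^sub>C\<close> 75)

class complex_vector = real_vector + scaleC +
  assumes scaleC_add_right: "c *\<^sub>C (x + y) = c *\<^sub>C x + c *\<^sub>C y"
    and scaleC_add_left: "(c + d) *\<^sub>C x = c *\<^sub>C x + d *\<^sub>C x"
    and scaleC_scaleC: "c *\<^sub>C d *\<^sub>C x = (c * d) *\<^sub>C x"
    and scaleC_one: "1 *\<^sub>C x = x"
    and scaleR_scaleC: "r *\<^sub>R x = complex_of_real r *\<^sub>C x"

lemma vector_space_scaleC: "vector_space (scaleC :: complex \<Rightarrow> 'a \<Rightarrow> 'a::complex_vector)"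
  by unfold_locales (simp_all add: scaleC_add_right scaleC_add_left scaleC_scaleC scaleC_one)

definition clinear :: "('a::complex_vector \<Rightarrow> 'b::complex_vector) \<Rightarrow> bool" where
  "clinear f \<longleftrightarrow> Vector_Spaces.linear scaleC scaleC f"

lemma clinear_iff:
  "clinear f \<longleftrightarrow> (\<forall>x y. f (x + y) = f x + f y) \<and> (\<forall>c x. f (c *\<^sub>C x) = c *\<^sub>C f x)"
  by (simp add: clinear_def Vector_Spaces.linear_iff vector_space_scaleC)

instantiation complex :: complex_vector
begin
definition scaleC_complex :: "complex \<Rightarrow> complex \<Rightarrow> complex" where
  "scaleC_complex c x = c * x"
instance
  by standard (simp_all add: scaleC_complex_def algebra_simps scaleR_conv_of_real)
end

instantiation vec :: (complex_vector, finite) complex_vector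
begin
definition scaleC_vec :: "complex \<Rightarrow> 'a ^ 'b \<Rightarrow> 'a ^ 'b" where
  "scaleC_vec c x = (\<chi> i. c *\<^sub>C x $ i)"
instance
  by standard (simp_all add: scaleC_vec_def vec_eq_iff scaleC_add_right scaleC_add_left
      scaleC_scaleC scaleC_one scaleR_scaleC)
end

text \<open>The pointwise real vector space structure on functions makes the library's
  \<^const>\<open>extreme_point_of\<close> applicable to sets of linear functionals and of linear maps.\<close>

instantiation "fun" :: (type, real_vector) real_vector
begin
definition scaleR_fun :: "real \<Rightarrow> ('a \<Rightarrow> 'b) \<Rightarrow> 'a \<Rightarrow> 'b" where
  "scaleR_fun r f = (\<lambda>x. r *\<^sub>R f x)"
instance
  by standard (simp_all add: scaleR_fun_def fun_eq_iff algebra_simps)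
end


section \<open>The Hilbert space of square-summable sequences\<close>

typedef ell2 = "{f :: nat \<Rightarrow> complex. summable (\<lambda>n. (cmod (f n))\<^sup>2)}"
  morphisms coord Abs_ell2
  by (rule exI[of _ "\<lambda>_. 0"]) simp

setup_lifting type_definition_ell2

lemma summable_coord: "summable (\<lambda>n. (cmod (coord x n))\<^sup>2)"
  using coord by blast

lemma ell2_eqI: "(\<And>n. coord x n = coord y n) \<Longrightarrow> x = y"
  by (metis coord_inject ext)

lemma square_summable_add:
  fixes f g :: "nat \<Rightarrow> complex"
  assumes "summable (\<lambda>n. (cmod (f n))\<^sup>2)" "summable (\<lambda>n. (cmod (g n))\<^sup>2)"
  shows "summable (\<lambda>n. (cmod (f n + g n))\<^sup>2)"
proof (rule summable_comparison_test)
  show "summable (\<lambda>n. 2 * (cmod (f n))\<^sup>2 + 2 * (cmod (g n))\<^sup>2)"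
    by (intro summable_add summable_mult assms)
  have "(cmod (f n + g n))\<^sup>2 \<le> 2 * (cmod (f n))\<^sup>2 + 2 * (cmod (g n))\<^sup>2" for n
  proof -
    have "(cmod (f n + g n))\<^sup>2 \<le> (cmod (f n) + cmod (g n))\<^sup>2"
      by (intro power_mono norm_triangle_ineq) simp
    also have "\<dots> \<le> 2 * (cmod (f n))\<^sup>2 + 2 * (cmod (g n))\<^sup>2"
      using zero_le_power2[of "cmod (f n) - cmod (g n)"]
      by (simp add: power2_eq_square algebra_simps)
    finally show ?thesis .
  qed
  then show "\<exists>N. \<forall>n\<ge>N. norm ((cmod (f n + g n))\<^sup>2) \<le> 2 * (cmod (f n))\<^sup>2 + 2 * (cmod (g n))\<^sup>2"
    by simp
qed

lemma square_summable_scale: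
  fixes f :: "nat \<Rightarrow> complex"
  shows "summable (\<lambda>n. (cmod (f n))\<^sup>2) \<Longrightarrow> summable (\<lambda>n. (cmod (c * f n))\<^sup>2)"
  by (simp add: norm_mult power_mult_distrib summable_mult)

instantiation ell2 :: ab_group_add
begin
lift_definition zero_ell2 :: ell2 is "\<lambda>_. 0" by simp
lift_definition plus_ell2 :: "ell2 \<Rightarrow> ell2 \<Rightarrow> ell2" is "\<lambda>f g n. f n + g n"
  by (rule square_summable_add)
lift_definition uminus_ell2 :: "ell2 \<Rightarrow> ell2" is "\<lambda>f n. - f n" by simp
definition minus_ell2 :: "ell2 \<Rightarrow> ell2 \<Rightarrow> ell2" where "minus_ell2 x y = x + - y"
instance
  by standard (unfold minus_ell2_def, (transfer, simp add: fun_eq_iff)+)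
end

instantiation ell2 :: complex_vector
begin
lift_definition scaleC_ell2 :: "complex \<Rightarrow> ell2 \<Rightarrow> ell2" is "\<lambda>c f n. c * f n"
  by (rule square_summable_scale)
definition scaleR_ell2 :: "real \<Rightarrow> ell2 \<Rightarrow> ell2" where
  "scaleR_ell2 r x = complex_of_real r *\<^sub>C x"
instance
  by standard (unfold scaleR_ell2_def, (transfer, simp add: fun_eq_iff algebra_simps)+)
end

lemma coord_simps [simp]:
  "coord 0 n = 0" "coord (x + y) n = coord x n + coord y n" "coord (- x) n = - coord x n"
  "coord (x - y) n = coord x n - coord y n" "coord (c *\<^sub>C x) n = c * coord x n"
  "coord (r *\<^sub>R x) n = complex_of_real r * coord x n"
  unfolding minus_ell2_def scaleR_ell2_def by (transfer, simp)+

lemma coord_sum [simp]: "coord (sum f A) n = (\<Sum>i\<in>A. coord (f i) n)"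
  by (induction A rule: infinite_finite_induct) auto

definition cinner :: "ell2 \<Rightarrow> ell2 \<Rightarrow> complex" where
  "cinner x y = (\<Sum>n. coord x n * cnj (coord y n))"

lemma summable_cinner: "summable (\<lambda>n. coord x n * cnj (coord y n))"
proof (rule summable_comparison_test)
  show "summable (\<lambda>n. (cmod (coord x n))\<^sup>2 + (cmod (coord y n))\<^sup>2)"
    by (intro summable_add summable_coord)
  have "cmod (coord x n) * cmod (coord y n) \<le> (cmod (coord x n))\<^sup>2 + (cmod (coord y n))\<^sup>2" for n
  proof -
    have "2 * (cmod (coord x n) * cmod (coord y n)) \<le> (cmod (coord x n))\<^sup>2 + (cmod (coord y n))\<^sup>2"
      using zero_le_power2[of "cmod (coord x n) - cmod (coord y n)"]
      by (simp add: power2_eq_square algebra_simps)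
    moreover have "0 \<le> cmod (coord x n) * cmod (coord y n)" by simp
    ultimately show ?thesis by linarith
  qed
  then show "\<exists>N. \<forall>n\<ge>N. norm (coord x n * cnj (coord y n))
      \<le> (cmod (coord x n))\<^sup>2 + (cmod (coord y n))\<^sup>2"
    by (simp add: norm_mult)
qed

lemma cinner_add_left: "cinner (x + y) z = cinner x z + cinner y z"
  by (simp add: cinner_def ring_distribs suminf_add[OF summable_cinner summable_cinner])

lemma cinner_scaleC_left: "cinner (c *\<^sub>C x) y = c * cinner x y"
  by (simp add: cinner_def mult.assoc suminf_mult[OF summable_cinner])

lemma cinner_commute: "cinner y x = cnj (cinner x y)"
proof -
  have "(\<lambda>n. cnj (coord x n * cnj (coord y n))) sums cnj (cinner x y)"
    unfolding cinner_def sums_cnj using summable_cinner summable_sums by blast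
  then show ?thesis
    by (simp add: cinner_def sums_iff mult.commute)
qed

lemma cinner_add_right: "cinner z (x + y) = cinner z x + cinner z y"
  by (metis cinner_add_left cinner_commute complex_cnj_add)

lemma cinner_scaleC_right: "cinner x (c *\<^sub>C y) = cnj c * cinner x y"
  by (metis cinner_scaleC_left cinner_commute complex_cnj_mult)

lemma cinner_self: "cinner x x = complex_of_real (\<Sum>n. (cmod (coord x n))\<^sup>2)"
  unfolding cinner_def complex_norm_square[symmetric]
  by (simp only: suminf_of_real[OF summable_coord])

instantiation ell2 :: real_inner
begin
definition inner_ell2 :: "ell2 \<Rightarrow> ell2 \<Rightarrow> real" where
  "inner_ell2 x y = Re (cinner x y)"
definition norm_ell2 :: "ell2 \<Rightarrow> real" where
  "norm_ell2 x = sqrt (inner x x)"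
definition sgn_ell2 :: "ell2 \<Rightarrow> ell2" where
  "sgn_ell2 x = x /\<^sub>R norm x"
definition dist_ell2 :: "ell2 \<Rightarrow> ell2 \<Rightarrow> real" where
  "dist_ell2 x y = norm (x - y)"
definition uniformity_ell2 :: "(ell2 \<times> ell2) filter" where
  "uniformity_ell2 = (INF e\<in>{0 <..}. principal {(x, y). dist x y < e})"
definition open_ell2 :: "ell2 set \<Rightarrow> bool" where
  "open_ell2 U \<longleftrightarrow> (\<forall>x\<in>U. eventually (\<lambda>(x', y). x' = x \<longrightarrow> y \<in> U) uniformity)"
instance
proof
  fix x y z :: ell2 and r :: real
  show "inner x y = inner y x"
    unfolding inner_ell2_def by (subst cinner_commute) simp
  show "inner (x + y) z = inner x z + inner y z"
    by (simp add: inner_ell2_def cinner_add_left)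
  show "inner (r *\<^sub>R x) y = r * inner x y"
    by (simp add: inner_ell2_def scaleR_scaleC cinner_scaleC_left)
  show "0 \<le> inner x x"
    by (simp add: inner_ell2_def cinner_self suminf_nonneg[OF summable_coord])
  show "inner x x = 0 \<longleftrightarrow> x = 0"
    by (auto simp: inner_ell2_def cinner_self suminf_eq_zero_iff[OF summable_coord]
        intro: ell2_eqI)
qed (simp_all add: norm_ell2_def sgn_ell2_def dist_ell2_def uniformity_ell2_def open_ell2_def)
end

lemma norm_ell2_square: "(norm x)\<^sup>2 = (\<Sum>n. (cmod (coord x n))\<^sup>2)"
  by (simp add: power2_norm_eq_inner inner_ell2_def cinner_self)

lemma cinner_norm: "cinner x x = complex_of_real ((norm x)\<^sup>2)"
  by (simp add: cinner_self norm_ell2_square)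

lemma norm_scaleC_ell2: "norm (c *\<^sub>C (x::ell2)) = cmod c * norm x"
proof -
  have "(norm (c *\<^sub>C x))\<^sup>2 = (cmod c * norm x)\<^sup>2"
    by (simp add: norm_ell2_square norm_mult power_mult_distrib suminf_mult[OF summable_coord])
  then show ?thesis by (simp add: power2_eq_iff_nonneg)
qed

lemma cinner_bound: "cmod (cinner x y) \<le> norm x * norm y"
proof -
  define c where "c = cnj (sgn (cinner x y))"
  have "c * cinner x y = complex_of_real (cmod (cinner x y))"
    by (auto simp: c_def sgn_eq complex_norm_square[symmetric] power2_eq_square
        mult.commute[of "cnj _"])
  then have "cmod (cinner x y) = Re (cinner (c *\<^sub>C x) y)"
    by (simp add: cinner_scaleC_left)
  also have "\<dots> \<le> norm (c *\<^sub>C x) * norm y"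
    using Cauchy_Schwarz_ineq2[of "c *\<^sub>C x" y] by (simp add: inner_ell2_def)
  also have "\<dots> \<le> 1 * norm x * norm y"
    by (intro mult_right_mono) (simp_all add: norm_scaleC_ell2 c_def norm_sgn mult_left_le_one_le)
  finally show ?thesis by simp
qed

lift_definition basis_vec :: "nat \<Rightarrow> ell2" (\<open>\<e>\<close>) is "\<lambda>n m. if m = n then 1 else 0"
  by (rule summable_finite[of "{_}"]) auto

lemma coord_basis_vec: "coord (\<e> n) m = (if m = n then 1 else 0)"
  by transfer simp


section \<open>Bounded operators\<close>

typedef bop = "{f :: ell2 \<Rightarrow> ell2. clinear f \<and> bounded_linear f}"
  morphisms app Abs_bop
  by (rule exI[of _ "\<lambda>_. 0"]) (simp add: clinear_iff bounded_linear_zero scaleC_ell2.abs_eq ell2_eqI)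

setup_lifting type_definition_bop

lemma bop_eqI: "(\<And>\<xi>. app x \<xi> = app y \<xi>) \<Longrightarrow> x = y"
  by (metis app_inject ext)

lemma app_linear: "app x (\<xi> + \<eta>) = app x \<xi> + app x \<eta>" "app x (c *\<^sub>C \<xi>) = c *\<^sub>C app x \<xi>"
  using app[of x] by (simp_all add: clinear_iff)

lemma app_bounded_linear: "bounded_linear (app x)"
  using app[of x] by simp

lemma bounded_linear_scaleC: "bounded_linear f \<Longrightarrow> bounded_linear (\<lambda>\<xi>. c *\<^sub>C (f \<xi> :: ell2))"
proof -
  assume f: "bounded_linear f"
  have "bounded_linear ((*\<^sub>C) c :: ell2 \<Rightarrow> ell2)"
    by (rule bounded_linear_intro[where K = "cmod c"])
      (simp_all add: scaleC_add_right scaleR_scaleC scaleC_scaleC norm_scaleC_ell2 mult.commute)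
  then show ?thesis
    using bounded_linear_compose f by blast
qed

instantiation bop :: ring_1
begin
lift_definition zero_bop :: bop is "\<lambda>_. 0"
  by (simp add: clinear_iff bounded_linear_zero ell2_eqI)
lift_definition one_bop :: bop is "\<lambda>\<xi>. \<xi>"
  by (simp add: clinear_iff bounded_linear_ident)
lift_definition plus_bop :: "bop \<Rightarrow> bop \<Rightarrow> bop" is "\<lambda>f g \<xi>. f \<xi> + g \<xi>"
  by (simp add: clinear_iff bounded_linear_add scaleC_add_right)
lift_definition uminus_bop :: "bop \<Rightarrow> bop" is "\<lambda>f \<xi>. - f \<xi>"
  by (simp add: clinear_iff bounded_linear_minus ell2_eqI)
lift_definition times_bop :: "bop \<Rightarrow> bop \<Rightarrow> bop" is "\<lambda>f g \<xi>. f (g \<xi>)"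
  by (simp add: clinear_iff bounded_linear_compose)
definition minus_bop :: "bop \<Rightarrow> bop \<Rightarrow> bop" where "minus_bop x y = x + - y"
instance
proof
  show "(0::bop) \<noteq> 1"
  proof
    assume "(0::bop) = 1"
    then have "app 0 (\<e> 0) = app 1 (\<e> 0)" by simp
    then have "\<e> 0 = 0" by (simp add: zero_bop.rep_eq one_bop.rep_eq)
    then have "coord (\<e> 0) 0 = 0" by simp
    then show False by (simp add: coord_basis_vec)
  qed
qed (unfold minus_bop_def, (transfer, simp add: clinear_iff fun_eq_iff)+)
end

instantiation bop :: complex_vector
begin
lift_definition scaleC_bop :: "complex \<Rightarrow> bop \<Rightarrow> bop" is "\<lambda>c f \<xi>. c *\<^sub>C f \<xi>"
  by (simp add: clinear_iff bounded_linear_scaleC scaleC_add_right scaleC_scaleC mult.commute)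
definition scaleR_bop :: "real \<Rightarrow> bop \<Rightarrow> bop" where
  "scaleR_bop r x = complex_of_real r *\<^sub>C x"
instance
  by standard (unfold scaleR_bop_def,
      (transfer, simp add: fun_eq_iff scaleC_add_right scaleC_add_left scaleC_scaleC scaleC_one)+)
end

lemma app_simps [simp]:
  "app 0 \<xi> = 0" "app 1 \<xi> = \<xi>" "app (x + y) \<xi> = app x \<xi> + app y \<xi>"
  "app (- x) \<xi> = - app x \<xi>" "app (x - y) \<xi> = app x \<xi> - app y \<xi>"
  "app (x * y) \<xi> = app x (app y \<xi>)" "app (c *\<^sub>C x) \<xi> = c *\<^sub>C app x \<xi>"
  by (simp_all only: zero_bop.rep_eq one_bop.rep_eq plus_bop.rep_eq uminus_bop.rep_eq
      times_bop.rep_eq scaleC_bop.rep_eq diff_conv_add_uminus)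

lemma bopI:
  assumes "clinear f" "\<And>\<xi>. norm (f \<xi>) \<le> norm \<xi> * K"
  shows "clinear f \<and> bounded_linear f"
  using assms by (auto simp: clinear_iff scaleR_scaleC intro!: bounded_linear_intro[of f K])

lift_definition diag_vec :: "(nat \<Rightarrow> complex) \<Rightarrow> ell2 \<Rightarrow> ell2" is
  "\<lambda>d f n. if bounded (range d) then d n * f n else 0"
proof -
  fix d f :: "nat \<Rightarrow> complex"
  assume f: "summable (\<lambda>n. (cmod (f n))\<^sup>2)"
  show "summable (\<lambda>n. (cmod (if bounded (range d) then d n * f n else 0))\<^sup>2)"
  proof (cases "bounded (range d)")
    case True
    then obtain K where K: "\<And>n. cmod (d n) \<le> K" by (auto simp: bounded_iff)
    have "summable (\<lambda>n. (cmod (d n * f n))\<^sup>2)"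
    proof (rule summable_comparison_test)
      show "summable (\<lambda>n. K\<^sup>2 * (cmod (f n))\<^sup>2)" by (intro summable_mult f)
      show "\<exists>N. \<forall>n\<ge>N. norm ((cmod (d n * f n))\<^sup>2) \<le> K\<^sup>2 * (cmod (f n))\<^sup>2"
        using K by (auto simp: norm_mult power_mult_distrib intro!: mult_right_mono power_mono)
    qed
    with True show ?thesis by simp
  qed simp
qed

text \<open>The diagonal operator with entries \<open>d n\<close>; the junk value for unbounded \<open>d\<close> is \<open>0\<close>.\<close>

lift_definition diag :: "(nat \<Rightarrow> complex) \<Rightarrow> bop" is diag_vec
proof -
  fix d :: "nat \<Rightarrow> complex"
  have lin: "clinear (diag_vec d)"
    unfolding clinear_iff
    by (auto intro!: ell2_eqI simp: diag_vec.rep_eq algebra_simps)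
  show "clinear (diag_vec d) \<and> bounded_linear (diag_vec d)"
  proof (cases "bounded (range d)")
    case True
    then obtain K where K: "\<And>n. cmod (d n) \<le> K" by (auto simp: bounded_iff)
    then have K0: "0 \<le> K" using norm_ge_zero order_trans by blast
    show ?thesis
    proof (rule bopI[OF lin])
      fix \<xi>
      have "(norm (diag_vec d \<xi>))\<^sup>2 \<le> (\<Sum>n. K\<^sup>2 * (cmod (coord \<xi> n))\<^sup>2)"
        unfolding norm_ell2_square
      proof (rule suminf_le)
        show "(cmod (coord (diag_vec d \<xi>) n))\<^sup>2 \<le> K\<^sup>2 * (cmod (coord \<xi> n))\<^sup>2" for n
          using K[of n] True
          by (auto simp: diag_vec.rep_eq norm_mult power_mult_distrib
              intro!: mult_right_mono power_mono)
      qed (rule summable_coord, rule summable_mult[OF summable_coord])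
      also have "\<dots> = (norm \<xi> * K)\<^sup>2"
        by (subst suminf_mult[OF summable_coord])
          (simp add: norm_ell2_square[symmetric] power_mult_distrib)
      finally show "norm (diag_vec d \<xi>) \<le> norm \<xi> * K"
        by (rule power2_le_imp_le) (use K0 in simp)
    qed
  next
    case False
    then have "diag_vec d \<xi> = 0" for \<xi>
      by (auto intro!: ell2_eqI simp: diag_vec.rep_eq)
    then show ?thesis by (intro bopI[OF lin, of 0]) simp
  qed
qed

lemma coord_diag:
  "bounded (range d) \<Longrightarrow> coord (app (diag d) \<xi>) n = d n * coord \<xi> n"
  by (simp add: diag.rep_eq diag_vec.rep_eq)

lemma diag_basis_vec: "bounded (range d) \<Longrightarrow> app (diag d) (\<e> n) = d n *\<^sub>C \<e> n"
  by (rule ell2_eqI) (simp add: coord_diag coord_basis_vec)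

lift_definition shift_vec :: "ell2 \<Rightarrow> ell2" is
  "\<lambda>f n. case n of 0 \<Rightarrow> 0 | Suc m \<Rightarrow> f m"
proof -
  fix f :: "nat \<Rightarrow> complex"
  assume "summable (\<lambda>n. (cmod (f n))\<^sup>2)"
  then show "summable (\<lambda>n. (cmod (case n of 0 \<Rightarrow> 0 | Suc m \<Rightarrow> f m))\<^sup>2)"
    by (subst summable_Suc_iff[symmetric]) simp
qed

lemma norm_shift_vec: "norm (shift_vec \<xi>) = norm \<xi>"
proof -
  have "(norm (shift_vec \<xi>))\<^sup>2 = (norm \<xi>)\<^sup>2"
    using suminf_split_head[OF summable_coord[of "shift_vec \<xi>"]]
    by (simp add: norm_ell2_square shift_vec.rep_eq)
  then show ?thesis by (simp add: power2_eq_iff_nonneg)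
qed

lift_definition shift :: bop is shift_vec
proof -
  have "clinear shift_vec"
    unfolding clinear_iff
    by (auto intro!: ell2_eqI simp: shift_vec.rep_eq split: nat.splits)
  then show "clinear shift_vec \<and> bounded_linear shift_vec"
    by (rule bopI[of _ 1]) (simp add: norm_shift_vec)
qed

lemma shift_basis_vec: "app shift (\<e> n) = \<e> (Suc n)"
  by (rule ell2_eqI) (auto simp: shift.rep_eq shift_vec.rep_eq coord_basis_vec split: nat.splits)

lift_definition proj0 :: bop is "\<lambda>\<xi>. cinner \<xi> (\<e> 0) *\<^sub>C \<e> 0"
proof -
  have "clinear (\<lambda>\<xi>. cinner \<xi> (\<e> 0) *\<^sub>C \<e> 0)"
    by (simp add: clinear_iff cinner_add_left cinner_scaleC_left scaleC_add_left scaleC_scaleC)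
  then show "clinear (\<lambda>\<xi>. cinner \<xi> (\<e> 0) *\<^sub>C \<e> 0) \<and> bounded_linear (\<lambda>\<xi>. cinner \<xi> (\<e> 0) *\<^sub>C \<e> 0)"
    by (rule bopI[of _ "norm (\<e> 0) * norm (\<e> 0)"])
      (simp add: norm_scaleC_ell2 mult.assoc[symmetric] mult_right_mono cinner_bound)
qed

definition adj :: "bop \<Rightarrow> bop" where
  "adj x = (THE y. \<forall>\<xi> \<eta>. cinner (app x \<xi>) \<eta> = cinner \<xi> (app y \<eta>))"

lemma cinner_basis_vec_right: "cinner \<xi> (\<e> n) = coord \<xi> n"
proof -
  have "(\<lambda>m. coord \<xi> m * cnj (coord (\<e> n) m)) = (\<lambda>m. if m = n then coord \<xi> m else 0)"
    by (auto simp: coord_basis_vec)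
  then show ?thesis
    by (simp add: cinner_def sums_unique[OF sums_single, symmetric])
qed

lemma cinner_basis_vec_left: "cinner (\<e> n) \<xi> = cnj (coord \<xi> n)"
  by (subst cinner_commute) (simp add: cinner_basis_vec_right)

lemma cinner_zero_left [simp]: "cinner 0 \<eta> = 0"
  by (simp add: cinner_def)

lemma cinner_sum_left: "cinner (sum f A) \<eta> = (\<Sum>i\<in>A. cinner (f i) \<eta>)"
  by (induction A rule: infinite_finite_induct)
    (simp_all add: cinner_add_left)

lemma app_zero_right [simp]: "app x 0 = 0"
  using app_bounded_linear linear_simps(3) by blast

lemma app_sum: "app x (sum f A) = (\<Sum>i\<in>A. app x (f i))"
  by (induction A rule: infinite_finite_induct) (auto simp: app_linear)

definition trunc :: "nat \<Rightarrow> ell2 \<Rightarrow> ell2" where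
  "trunc N \<xi> = (\<Sum>n<N. coord \<xi> n *\<^sub>C \<e> n)"

lemma coord_trunc: "coord (trunc N \<xi>) n = (if n < N then coord \<xi> n else 0)"
proof -
  have "coord (trunc N \<xi>) n = (\<Sum>m<N. if n = m then coord \<xi> m else 0)"
    unfolding trunc_def coord_sum by (rule sum.cong) (auto simp: coord_basis_vec)
  then show ?thesis by (simp add: sum.delta')
qed

lemma trunc_tendsto: "(\<lambda>N. trunc N \<xi>) \<longlonglongrightarrow> \<xi>"
proof -
  have "(norm (\<xi> - trunc N \<xi>))\<^sup>2 = (\<Sum>n. (cmod (coord \<xi> (n + N)))\<^sup>2)" for N
    unfolding norm_ell2_square
    by (subst suminf_split_initial_segment[OF summable_coord, of _ N]) (simp add: coord_trunc)
  moreover have "(\<lambda>N. (\<Sum>n. (cmod (coord \<xi> (n + N)))\<^sup>2)) \<longlonglongrightarrow> 0"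
    using suminf_exist_split2[OF summable_coord] by simp
  ultimately have "(\<lambda>N. (norm (\<xi> - trunc N \<xi>))\<^sup>2) \<longlonglongrightarrow> 0" by simp
  then have "(\<lambda>N. sqrt ((norm (\<xi> - trunc N \<xi>))\<^sup>2)) \<longlonglongrightarrow> sqrt 0"
    by (rule tendsto_real_sqrt)
  then have "(\<lambda>N. norm (trunc N \<xi> - \<xi>)) \<longlonglongrightarrow> 0"
    by (simp add: norm_minus_commute)
  then show ?thesis
    using LIM_zero_cancel tendsto_norm_zero_iff by blast
qed

lemma bounded_linear_cinner_left: "bounded_linear (\<lambda>\<xi>. cinner \<xi> \<eta>)"
  by (rule bounded_linear_intro[where K = "norm \<eta>"])
    (simp_all add: cinner_add_left scaleR_scaleC cinner_scaleC_left cinner_bound scaleC_complex_def)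

lemma adj_exists: "\<exists>y. \<forall>\<xi> \<eta>. cinner (app x \<xi>) \<eta> = cinner \<xi> (app y \<eta>)"
proof -
  obtain K where K: "\<And>\<xi>. norm (app x \<xi>) \<le> norm \<xi> * K" and K0: "K \<ge> 0"
    using bounded_linear.nonneg_bounded[OF app_bounded_linear[of x]] by blast
  define g where "g \<eta> n = cinner \<eta> (app x (\<e> n))" for \<eta> n
  have cg: "cnj (g \<eta> n) = cinner (app x (\<e> n)) \<eta>" for \<eta> n
    unfolding g_def by (subst cinner_commute) simp
  have fin: "(\<Sum>n<N. (cmod (g \<eta> n))\<^sup>2) \<le> (K * norm \<eta>)\<^sup>2" for \<eta> N
  proof -
    define \<zeta> where "\<zeta> = (\<Sum>n<N. g \<eta> n *\<^sub>C \<e> n)"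
    define S where "S = (\<Sum>n<N. (cmod (g \<eta> n))\<^sup>2)"
    have S0: "S \<ge> 0" by (simp add: S_def sum_nonneg)
    have c\<zeta>: "coord \<zeta> n = (if n < N then g \<eta> n else 0)" for n
    proof -
      have "coord \<zeta> n = (\<Sum>m<N. if n = m then g \<eta> m else 0)"
        unfolding \<zeta>_def coord_sum by (rule sum.cong) (auto simp: coord_basis_vec)
      then show ?thesis by (simp add: sum.delta')
    qed
    have "(norm \<zeta>)\<^sup>2 = (\<Sum>n. if n < N then (cmod (g \<eta> n))\<^sup>2 else 0)"
      unfolding norm_ell2_square by (intro arg_cong[of _ _ suminf] ext) (simp add: c\<zeta>)
    also have "\<dots> = S"
      unfolding S_def
      by (subst suminf_finite[of "{..<N}"]) auto
    finally have n\<zeta>: "norm \<zeta> = sqrt S" by (metis norm_ge_zero real_sqrt_unique)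
    have "cinner (app x \<zeta>) \<eta> = (\<Sum>n<N. g \<eta> n * cnj (g \<eta> n))"
      by (simp add: \<zeta>_def app_sum cinner_sum_left app_linear cinner_scaleC_left cg)
    also have "\<dots> = complex_of_real S"
      by (simp add: S_def complex_norm_square del: of_real_power)
    finally have "S = cmod (cinner (app x \<zeta>) \<eta>)" using S0 by simp
    also have "\<dots> \<le> norm (app x \<zeta>) * norm \<eta>" by (rule cinner_bound)
    also have "\<dots> \<le> sqrt S * K * norm \<eta>" using K[of \<zeta>] n\<zeta> by (simp add: mult_right_mono)
    finally have le: "S \<le> sqrt S * (K * norm \<eta>)" by (simp add: mult.assoc)
    have "sqrt S \<le> K * norm \<eta>"
    proof (cases "S = 0")
      case False
      then have "sqrt S > 0" using S0 by simp
      moreover have "sqrt S * sqrt S \<le> sqrt S * (K * norm \<eta>)" using le S0 by simp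
      ultimately show ?thesis by (rule mult_left_le_imp_le[rotated])
    qed (use K0 in simp)
    then have "(sqrt S)\<^sup>2 \<le> (K * norm \<eta>)\<^sup>2" by (intro power_mono) (use S0 in auto)
    then show ?thesis using S0 by (simp add: S_def)
  qed
  have sm: "summable (\<lambda>n. (cmod (g \<eta> n))\<^sup>2)" for \<eta>
    by (rule summableI_nonneg_bounded[where x = "(K * norm \<eta>)\<^sup>2"]) (simp, rule fin)
  define y where "y \<eta> = Abs_ell2 (g \<eta>)" for \<eta>
  have cy: "coord (y \<eta>) n = g \<eta> n" for \<eta> n
    unfolding y_def by (subst Abs_ell2_inverse) (simp_all add: sm)
  have lin: "clinear y"
    unfolding clinear_iff
    by (auto intro!: ell2_eqI simp: cy g_def cinner_add_left cinner_scaleC_left)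
  have bd: "norm (y \<eta>) \<le> norm \<eta> * K" for \<eta>
  proof (rule power2_le_imp_le)
    show "(norm (y \<eta>))\<^sup>2 \<le> (norm \<eta> * K)\<^sup>2"
      unfolding norm_ell2_square cy using suminf_le_const[OF sm fin] by (simp add: mult.commute)
  qed (use K0 in simp)
  define Y where "Y = Abs_bop y"
  have aY: "app Y \<eta> = y \<eta>" for \<eta>
    unfolding Y_def using bopI[OF lin bd] by (simp add: Abs_bop_inverse)
  have "cinner (app x \<xi>) \<eta> = cinner \<xi> (app Y \<eta>)" for \<xi> \<eta>
  proof -
    have "cinner (app x (trunc N \<xi>)) \<eta> = cinner (trunc N \<xi>) (y \<eta>)" for N
      by (simp add: trunc_def app_sum cinner_sum_left app_linear cinner_scaleC_left
          cinner_basis_vec_left cy cg)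
    moreover have "(\<lambda>N. cinner (app x (trunc N \<xi>)) \<eta>) \<longlonglongrightarrow> cinner (app x \<xi>) \<eta>"
      by (intro bounded_linear.tendsto[OF bounded_linear_cinner_left]
          bounded_linear.tendsto[OF app_bounded_linear] trunc_tendsto)
    moreover have "(\<lambda>N. cinner (trunc N \<xi>) (y \<eta>)) \<longlonglongrightarrow> cinner \<xi> (y \<eta>)"
      by (intro bounded_linear.tendsto[OF bounded_linear_cinner_left] trunc_tendsto)
    ultimately show ?thesis using LIMSEQ_unique by (simp add: aY)
  qed
  then show ?thesis by blast
qed

lemma cinner_adj: "cinner (app x \<xi>) \<eta> = cinner \<xi> (app (adj x) \<eta>)"
proof -
  obtain y where y: "\<forall>\<xi> \<eta>. cinner (app x \<xi>) \<eta> = cinner \<xi> (app y \<eta>)"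
    using adj_exists by blast
  have "z = y" if z: "\<forall>\<xi> \<eta>. cinner (app x \<xi>) \<eta> = cinner \<xi> (app z \<eta>)" for z
  proof (intro bop_eqI ell2_eqI)
    fix \<eta> n
    have "cinner (\<e> n) (app z \<eta>) = cinner (\<e> n) (app y \<eta>)"
      by (rule trans[OF z[rule_format, symmetric] y[rule_format]])
    then show "coord (app z \<eta>) n = coord (app y \<eta>) n" by (simp add: cinner_basis_vec_left)
  qed
  then have "adj x = y" unfolding adj_def using y by (rule the_equality[rotated])
  then show ?thesis using y by simp
qed


section \<open>Unital completely positive normal maps\<close>

text \<open>Positivity of an operator matrix \<open>X i j\<close> with \<open>i, j < n\<close>, acting on the direct sum of
  \<open>n\<close> copies of the Hilbert space.\<close>

definition pos_matrix :: "nat \<Rightarrow> (nat \<Rightarrow> nat \<Rightarrow> bop) \<Rightarrow> bool" where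
  "pos_matrix n X \<longleftrightarrow>
    (\<forall>\<xi> :: nat \<Rightarrow> ell2. (\<Sum>i<n. \<Sum>j<n. cinner (app (X i j) (\<xi> j)) (\<xi> i)) \<in> \<real>\<^sub>\<ge>\<^sub>0)"

definition completely_positive :: "(bop \<Rightarrow> bop) \<Rightarrow> bool" where
  "completely_positive T \<longleftrightarrow>
    (\<forall>n X. pos_matrix n X \<longrightarrow> pos_matrix n (\<lambda>i j. T (X i j)))"

text \<open>Normality is continuity for the ultraweak (sigma-weak) topology, the initial topology of the
  functionals below.\<close>

definition ultraweak_functionals :: "(bop \<Rightarrow> complex) set" where
  "ultraweak_functionals =
    {(\<lambda>x. \<Sum>n. cinner (app x (\<xi> n)) (\<eta> n)) | \<xi> \<eta> :: nat \<Rightarrow> ell2.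
      summable (\<lambda>n. (norm (\<xi> n))\<^sup>2) \<and> summable (\<lambda>n. (norm (\<eta> n))\<^sup>2)}"

definition ultraweak_topology :: "bop topology" where
  "ultraweak_topology = topology_generated_by {f -` U | f U. f \<in> ultraweak_functionals \<and> open U}"

definition normal_map :: "(bop \<Rightarrow> bop) \<Rightarrow> bool" where
  "normal_map T \<longleftrightarrow> continuous_map ultraweak_topology ultraweak_topology T"

definition UCP :: "(bop \<Rightarrow> bop) set" where
  "UCP = {T. clinear T \<and> T 1 = 1 \<and> completely_positive T \<and> normal_map T}"


section \<open>States on the two-by-two matrices\<close>

definition conj_transpose :: "complex ^ 2 ^ 2 \<Rightarrow> complex ^ 2 ^ 2" where
  "conj_transpose y = (\<chi> i j. cnj (y $ j $ i))"

definition states :: "(complex ^ 2 ^ 2 \<Rightarrow> complex) set" where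
  "states = {\<psi>. clinear \<psi> \<and> (\<forall>y. \<psi> (conj_transpose y ** y) \<in> \<real>\<^sub>\<ge>\<^sub>0) \<and> \<psi> (mat 1) = 1}"

definition pure_state :: "(complex ^ 2 ^ 2 \<Rightarrow> complex) \<Rightarrow> bool" where
  "pure_state \<psi> \<longleftrightarrow> \<psi> extreme_point_of states"

definition psi_plus :: "complex ^ 2 ^ 2 \<Rightarrow> complex" where
  "psi_plus y = y $ 1 $ 1"


section \<open>Transition operators\<close>

text \<open>Operators on the tensor product with the two-dimensional space are the two-by-two matrices
  of type \<^typ>\<open>bop ^ 2 ^ 2\<close>, multiplied by \<^const>\<open>matrix_matrix_mult\<close>.\<close>

definition tensor :: "bop \<Rightarrow> complex ^ 2 ^ 2 \<Rightarrow> bop ^ 2 ^ 2" where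
  "tensor x y = (\<chi> i j. y $ i $ j *\<^sub>C x)"

definition adj_matrix :: "bop ^ 2 ^ 2 \<Rightarrow> bop ^ 2 ^ 2" where
  "adj_matrix X = (\<chi> i j. adj (X $ j $ i))"

definition matrix_unit :: "2 \<Rightarrow> 2 \<Rightarrow> complex ^ 2 ^ 2" where
  "matrix_unit i j = (\<chi> k l. if k = i \<and> l = j then 1 else 0)"

text \<open>An operator \<open>X\<close> is the sum of the elementary tensors \<open>tensor (X $ i $ j) (matrix_unit i j)\<close>;
  see \<open>slice_unique\<close> for the characterisation of the slice map as a linear extension.\<close>

definition slice :: "(complex ^ 2 ^ 2 \<Rightarrow> complex) \<Rightarrow> bop ^ 2 ^ 2 \<Rightarrow> bop" where
  "slice \<psi> X = (\<Sum>i\<in>UNIV. \<Sum>j\<in>UNIV. \<psi> (matrix_unit i j) *\<^sub>C X $ i $ j)"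

lemma clinear_sum:
  assumes "clinear f"
  shows "f (sum g A) = (\<Sum>i\<in>A. f (g i))"
proof -
  have "module_hom scaleC scaleC f"
    using assms unfolding clinear_def by (rule Vector_Spaces.linear.axioms(3))
  then show ?thesis by (rule module_hom.sum)
qed

lemma scaleC_zero [simp]: "0 *\<^sub>C (x :: 'a::complex_vector) = 0"
  using scaleR_scaleC[of 0 x] by simp

lemma matrix_unit_expand:
  "y = (\<Sum>i\<in>UNIV. \<Sum>j\<in>UNIV. y $ i $ j *\<^sub>C matrix_unit i j)"
  by (auto simp: vec_eq_iff sum_2 scaleC_vec_def matrix_unit_def forall_2 scaleC_complex_def)

lemma tensor_expand:
  "X = (\<Sum>i\<in>UNIV. \<Sum>j\<in>UNIV. tensor (X $ i $ j) (matrix_unit i j))"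
  by (auto simp: vec_eq_iff sum_2 tensor_def matrix_unit_def forall_2 scaleC_one)

lemma clinear_slice: "clinear (slice \<psi>)"
  by (simp add: clinear_iff slice_def sum_2 scaleC_vec_def scaleC_add_right scaleC_scaleC
      mult.commute)

lemma slice_tensor:
  assumes "clinear \<psi>"
  shows "slice \<psi> (tensor x y) = \<psi> y *\<^sub>C x"
proof -
  have "\<psi> y = (\<Sum>i\<in>UNIV. \<Sum>j\<in>UNIV. y $ i $ j * \<psi> (matrix_unit i j))"
    using arg_cong[OF matrix_unit_expand[of y], of \<psi>] assms
    by (simp only: clinear_sum[OF assms]) (simp add: clinear_iff scaleC_complex_def)
  then show ?thesis
    by (simp add: slice_def tensor_def sum_2 scaleC_add_left scaleC_scaleC mult.commute)
qed

lemma slice_unique: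
  assumes "clinear \<psi>" "clinear P" "\<And>x y. P (tensor x y) = \<psi> y *\<^sub>C x"
  shows "P = slice \<psi>"
proof
  fix X
  show "P X = slice \<psi> X"
    using arg_cong[OF tensor_expand[of X], of P]
    by (simp only: clinear_sum[OF assms(2)] assms(3) slice_def)
qed

definition coupling :: "(nat \<Rightarrow> real) \<Rightarrow> (nat \<Rightarrow> real) \<Rightarrow> bop ^ 2 ^ 2" where
  "coupling \<alpha> \<beta> =
    (let a = diag (\<lambda>n. complex_of_real (\<alpha> n));
         b = diag (\<lambda>n. complex_of_real (\<beta> n));
         s = shift
     in vector [vector [adj s * a * s, \<i> *\<^sub>C (adj s * b)],
                vector [\<i> *\<^sub>C (b * s), a]])"

definition transition ::
  "(nat \<Rightarrow> real) \<Rightarrow> (nat \<Rightarrow> real) \<Rightarrow> (complex ^ 2 ^ 2 \<Rightarrow> complex) \<Rightarrow> bop \<Rightarrow> bop" where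
  "transition \<alpha> \<beta> \<psi> x =
    slice \<psi> (adj_matrix (coupling \<alpha> \<beta>) ** tensor x (mat 1) ** coupling \<alpha> \<beta>)"

end

theory Submission
  imports Defs
begin

text \<open>Everything rests on Kraus representations \<open>T x = (\<Sum>k. v\<^sub>k\<^sup>* x v\<^sub>k)\<close> and on Choi's criterion:
  such a unital map is extreme as soon as the products \<open>v\<^sub>j\<^sup>* v\<^sub>k\<close> are linearly independent
  (\<open>kraus_map_extreme_point\<close>). The criterion follows from a Radon-Nikodym statement: a normal
  completely positive map dominated by \<open>T\<close> is \<open>\<Sum>j k. c\<^sub>j\<^sub>k v\<^sub>j\<^sup>* x v\<^sub>k\<close> for some scalars
  \<open>c\<^sub>j\<^sub>k\<close>; evaluating at \<open>x = 1\<close> and using independence forces \<open>c\<^sub>j\<^sub>k = \<delta>\<^sub>j\<^sub>k\<close>, so that no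
  proper convex decomposition of \<open>T\<close> exists. The scalars are found on matrix units, where complete
  positivity is positivity of the Choi matrix (\<open>dominated_by_kraus_map\<close>), and they are carried to
  all operators by normality (\<open>normal_map_ext\<close>).

  For the vector state of \<open>\<eta>\<close> the transition operator has the Kraus operators
  \<open>v\<^sub>k = \<eta>\<^sub>1 u\<^sub>k\<^sub>1 + \<eta>\<^sub>2 u\<^sub>k\<^sub>2\<close>. Each of them has at most two nonzero diagonals, so
  relations between the four products are decided by a few matrix entries. If \<open>\<eta>\<^sub>2 \<noteq> 0\<close> the
  products are independent (\<open>K_independent\<close>), which makes pure states other than \<open>psi_plus\<close> give
  extreme operators. Conversely \<open>\<psi> \<mapsto> T\<^sub>\<psi>\<close> is affine and injective on states
  (\<open>transition_inj\<close>), so it takes a proper convex combination of states to a proper convex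
  combination of maps.

  For \<open>psi_plus\<close> the Kraus operators are \<open>v\<^sub>1 = s\<^sup>* a s\<close> and \<open>v\<^sub>2 = i b s\<close>. The products
  \<open>v\<^sub>1\<^sup>* v\<^sub>1\<close> and \<open>v\<^sub>2\<^sup>* v\<^sub>2\<close> are diagonal with entries \<open>\<alpha>\<^sub>n\<^sub>+\<^sub>1\<^sup>2\<close> and \<open>1 - \<alpha>\<^sub>n\<^sub>+\<^sub>1\<^sup>2\<close>, and
  \<open>v\<^sub>1\<^sup>* v\<^sub>2\<close> is a weighted shift with weights \<open>i \<beta>\<^sub>n\<^sub>+\<^sub>1 \<alpha>\<^sub>n\<^sub>+\<^sub>2\<close>. If \<open>v\<^sub>1 = 0\<close> there is only one
  Kraus operator and the map is extreme. Otherwise independence fails in only two ways. Either \<open>\<alpha>\<^sub>n\<^sub>+\<^sub>1\<^sup>2\<close>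
  is a constant \<open>t\<close>, and then \<open>v\<^sub>1\<close> and \<open>v\<^sub>2\<close> are multiples of isometries and the map is a mixture
  of two isometric conjugations; or \<open>v\<^sub>1\<^sup>* v\<^sub>2 = 0\<close>, that is \<open>\<alpha>\<^sub>n = 0\<close> for \<open>n \<ge> 2\<close>, and then the map is
  the average of the conjugations by the isometries \<open>v\<^sub>1 + v\<^sub>2\<close> and \<open>v\<^sub>1 - v\<^sub>2\<close>. These are the
  scalar and the \<open>proj0\<close> alternative.\<close>

section \<open>Matrix coefficients of bounded operators\<close>

lemma scaleC_zero_right [simp]: "c *\<^sub>C 0 = (0 :: 'a::complex_vector)"
  using scaleC_scaleC[of c 0 "0 :: 'a"] by simp

lemma scaleC_sum_right: "c *\<^sub>C sum f A = (\<Sum>i\<in>A. c *\<^sub>C f i)" for f :: "'i \<Rightarrow> 'a::complex_vector"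
  by (rule clinear_sum[where f = "(*\<^sub>C) c"])
    (simp add: clinear_iff scaleC_add_right scaleC_scaleC mult.commute)

lemma cinner_diff_right: "cinner z (x - y) = cinner z x - cinner z y"
  using cinner_add_right[of z "x - y" y] by simp

lemma cinner_zero_right [simp]: "cinner \<xi> 0 = 0"
  by (subst cinner_commute) simp

lemma cinner_adj_left: "cinner (app (adj x) \<xi>) \<eta> = cinner \<xi> (app x \<eta>)"
  by (metis cinner_adj cinner_commute)

lemma coord_adj: "coord (app (adj x) \<xi>) n = cinner \<xi> (app x (\<e> n))"
  by (simp add: cinner_adj_left flip: cinner_basis_vec_right)

text \<open>That a bounded operator is determined by its matrix is a matter of continuity, which enters
  through the adjoint: the coordinates of \<open>adj x\<close> at a basis vector are the conjugates of a row of
  the matrix of \<open>x\<close>.\<close>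

lemma bop_eqI_basis:
  assumes "\<And>n m. coord (app x (\<e> n)) m = coord (app y (\<e> n)) m"
  shows "x = y"
proof (intro bop_eqI ell2_eqI)
  fix \<xi> m
  have "app (adj x) (\<e> m) = app (adj y) (\<e> m)"
    using assms by (intro ell2_eqI) (simp add: coord_adj cinner_basis_vec_left)
  then show "coord (app x \<xi>) m = coord (app y \<xi>) m"
    by (metis cinner_adj cinner_basis_vec_right)
qed

lemma app_sum_left: "app (sum f A) \<xi> = (\<Sum>i\<in>A. app (f i) \<xi>)"
  by (induction A rule: infinite_finite_induct) simp_all

lemma adj_unique:
  assumes "\<And>\<xi> \<eta>. cinner (app x \<xi>) \<eta> = cinner \<xi> (app y \<eta>)"
  shows "adj x = y"
proof (rule bop_eqI_basis)
  fix n m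
  have "coord (app (adj x) (\<e> n)) m = cnj (cinner (app x (\<e> m)) (\<e> n))"
    by (subst cinner_commute[symmetric]) (rule coord_adj)
  also have "\<dots> = coord (app y (\<e> n)) m"
    by (simp add: assms cinner_basis_vec_left)
  finally show "coord (app (adj x) (\<e> n)) m = coord (app y (\<e> n)) m" .
qed

lemma adj_scaleC: "adj (c *\<^sub>C x) = cnj c *\<^sub>C adj x"
  by (rule adj_unique) (simp add: cinner_scaleC_left cinner_scaleC_right cinner_adj)

lemma adj_add: "adj (x + y) = adj x + adj y"
  by (rule adj_unique) (simp add: cinner_add_left cinner_add_right cinner_adj)

lemma adj_diff: "adj (x - y) = adj x - adj y"
  using adj_add[of "x - y" y] by simp

lemma scaleC_mult_bop:
  "(c *\<^sub>C x) * y = c *\<^sub>C (x * y)" "x * (c *\<^sub>C y) = c *\<^sub>C (x * y)" for x y :: bop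
  by (rule bop_eqI, simp add: app_linear)+

definition rank_one :: "ell2 \<Rightarrow> ell2 \<Rightarrow> bop" where
  "rank_one \<xi> \<eta> = Abs_bop (\<lambda>\<zeta>. cinner \<zeta> \<eta> *\<^sub>C \<xi>)"

lemma app_rank_one [simp]: "app (rank_one \<xi> \<eta>) \<zeta> = cinner \<zeta> \<eta> *\<^sub>C \<xi>"
proof -
  have "clinear (\<lambda>\<zeta>. cinner \<zeta> \<eta> *\<^sub>C \<xi>)"
    by (simp add: clinear_iff cinner_add_left cinner_scaleC_left scaleC_add_left scaleC_scaleC)
  then have "clinear (\<lambda>\<zeta>. cinner \<zeta> \<eta> *\<^sub>C \<xi>) \<and> bounded_linear (\<lambda>\<zeta>. cinner \<zeta> \<eta> *\<^sub>C \<xi>)"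
    by (rule bopI[of _ "norm \<eta> * norm \<xi>"])
      (simp add: norm_scaleC_ell2 mult.assoc[symmetric] mult_right_mono cinner_bound)
  then show ?thesis by (simp add: rank_one_def Abs_bop_inverse)
qed

section \<open>The ultraweak topology\<close>

lemma summable_norm_mult:
  fixes f g :: "nat \<Rightarrow> 'a::real_normed_vector"
  assumes "summable (\<lambda>n. (norm (f n))\<^sup>2)" "summable (\<lambda>n. (norm (g n))\<^sup>2)"
  shows "summable (\<lambda>n. norm (f n) * norm (g n))"
proof (rule summable_comparison_test)
  show "summable (\<lambda>n. (norm (f n))\<^sup>2 + (norm (g n))\<^sup>2)"
    by (intro summable_add assms)
  have "norm (f n) * norm (g n) \<le> (norm (f n))\<^sup>2 + (norm (g n))\<^sup>2" for n
    using sum_squares_bound[of "norm (f n)" "norm (g n)"]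
          mult_nonneg_nonneg[OF norm_ge_zero[of "f n"] norm_ge_zero[of "g n"]] by linarith
  then show "\<exists>N. \<forall>n\<ge>N. norm (norm (f n) * norm (g n)) \<le> (norm (f n))\<^sup>2 + (norm (g n))\<^sup>2"
    by simp
qed

lemma app_bound: obtains K where "K \<ge> 0" "\<And>\<xi>. norm (app x \<xi>) \<le> K * norm \<xi>"
  using bounded_linear.nonneg_bounded[OF app_bounded_linear[of x]] by (metis mult.commute)

lemma summable_app:
  assumes "summable (\<lambda>n. (norm (\<xi> n))\<^sup>2)"
  shows "summable (\<lambda>n. (norm (app x (\<xi> n)))\<^sup>2)"
proof -
  obtain K where K: "K \<ge> 0" "\<And>\<xi>. norm (app x \<xi>) \<le> K * norm \<xi>" using app_bound[of x] by blast
  have "(norm (app x \<xi>))\<^sup>2 \<le> K\<^sup>2 * (norm \<xi>)\<^sup>2" for \<xi>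
    using power_mono[OF K(2)] by (simp add: power_mult_distrib)
  then show ?thesis
    by (intro summable_comparison_test[OF _ summable_mult[OF assms, of "K\<^sup>2"]]) auto
qed

lemma summable_cinner_seq:
  assumes "summable (\<lambda>n. (norm (\<xi> n))\<^sup>2)" "summable (\<lambda>n. (norm (\<eta> n))\<^sup>2)"
  shows "summable (\<lambda>n. cinner (\<xi> n) (\<eta> n))"
  by (rule summable_norm_cancel, rule summable_comparison_test[OF _ summable_norm_mult[OF assms]])
    (auto intro: cinner_bound)

lemma ultraweak_functionalsI:
  assumes "summable (\<lambda>n. (norm (\<xi> n))\<^sup>2)" "summable (\<lambda>n. (norm (\<eta> n))\<^sup>2)"
  shows "(\<lambda>x. \<Sum>n. cinner (app x (\<xi> n)) (\<eta> n)) \<in> ultraweak_functionals"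
  using assms unfolding ultraweak_functionals_def by blast

lemma topspace_ultraweak [simp]: "topspace ultraweak_topology = UNIV"
proof -
  have "(\<lambda>x. \<Sum>n. cinner (app x 0) 0) \<in> ultraweak_functionals"
    using ultraweak_functionalsI[of "\<lambda>_. 0" "\<lambda>_. 0"] by simp
  then have "UNIV \<in> {f -` U | f U. f \<in> ultraweak_functionals \<and> open U}"
    by (smt (verit) mem_Collect_eq open_UNIV vimage_UNIV)
  then show ?thesis unfolding ultraweak_topology_def topology_generated_by_topspace by blast
qed

lemma continuous_ultraweak_functional:
  assumes "f \<in> ultraweak_functionals"
  shows "continuous_map ultraweak_topology euclidean f"
proof -
  have "openin ultraweak_topology (f -` U)" if "open U" for U
    unfolding ultraweak_topology_def using assms that
    by (intro topology_generated_by_Basis) blast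
  then show ?thesis by (simp add: continuous_map_def vimage_def)
qed

text \<open>The universal property of an initial topology.\<close>

lemma continuous_into_ultraweak:
  assumes "\<And>f. f \<in> ultraweak_functionals \<Longrightarrow> continuous_map X euclidean (f \<circ> T)"
  shows "continuous_map X ultraweak_topology T"
  unfolding ultraweak_topology_def
proof (rule continuous_on_generated_topo)
  fix V assume "V \<in> {f -` U | f U. f \<in> ultraweak_functionals \<and> open U}"
  then obtain f U where f: "f \<in> ultraweak_functionals" "open U" and V: "V = f -` U" by blast
  have "T -` V \<inter> topspace X = {x \<in> topspace X. (f \<circ> T) x \<in> U}" using V by auto
  then show "openin X (T -` V \<inter> topspace X)"
    using assms[OF f(1)] f(2) by (simp add: continuous_map_def)
next
  show "T ` topspace X \<subseteq> \<Union> {f -` U | f U. f \<in> ultraweak_functionals \<and> open U}"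
    using topspace_ultraweak unfolding ultraweak_topology_def topology_generated_by_topspace by simp
qed

lemma norm_trunc_le: "norm (trunc N \<xi>) \<le> norm \<xi>"
proof (rule power2_le_imp_le)
  have "(\<Sum>n. (cmod (coord (trunc N \<xi>) n))\<^sup>2) \<le> (\<Sum>n. (cmod (coord \<xi> n))\<^sup>2)"
    by (intro suminf_le summable_coord) (simp add: coord_trunc)
  then show "(norm (trunc N \<xi>))\<^sup>2 \<le> (norm \<xi>)\<^sup>2" by (simp add: norm_ell2_square)
qed simp

text \<open>The corner \<open>p x p\<close>, for \<open>p\<close> the projection onto the first \<open>N\<close> basis vectors. It is written as
  a combination of matrix units so that a linear map is determined on it by its values at matrix
  units.\<close>

definition compression :: "nat \<Rightarrow> bop \<Rightarrow> bop" where
  "compression N x = (\<Sum>m<N. \<Sum>n<N. coord (app x (\<e> n)) m *\<^sub>C rank_one (\<e> m) (\<e> n))"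

lemma app_compression: "app (compression N x) \<xi> = trunc N (app x (trunc N \<xi>))"
proof -
  have "coord (app x (trunc N \<xi>)) m = (\<Sum>n<N. coord \<xi> n * coord (app x (\<e> n)) m)" for m
    by (simp add: trunc_def app_sum app_linear)
  then show ?thesis
    unfolding trunc_def[of N "app x _"]
    by (intro ell2_eqI)
      (simp add: compression_def app_sum_left cinner_basis_vec_right sum_distrib_left ac_simps)
qed

lemma cinner_trunc: "cinner (trunc N \<xi>) \<eta> = cinner \<xi> (trunc N \<eta>)"
  by (simp add: cinner_def coord_trunc if_distrib if_distribR cong: if_cong)

text \<open>Every term of the series of an ultraweak functional converges because truncation converges
  strongly. Since truncation is contractive, the terms are dominated by
  \<open>K * (norm (\<xi> n) * norm (\<eta> n))\<close>, with \<open>K\<close> a bound for \<open>x\<close>, and Tannery's theorem applies.\<close>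

lemma compression_ultraweak_tendsto:
  assumes "f \<in> ultraweak_functionals"
  shows "(\<lambda>N. f (compression N x)) \<longlonglongrightarrow> f x"
proof -
  obtain \<xi> \<eta> where f: "f = (\<lambda>x. \<Sum>n. cinner (app x (\<xi> n)) (\<eta> n))"
    and s: "summable (\<lambda>n. (norm (\<xi> n))\<^sup>2)" "summable (\<lambda>n. (norm (\<eta> n))\<^sup>2)"
    using assms unfolding ultraweak_functionals_def by blast
  obtain K where K: "K \<ge> 0" "\<And>\<xi>. norm (app x \<xi>) \<le> K * norm \<xi>" using app_bound[of x] by blast
  have "(\<lambda>N. \<Sum>n. cinner (app (compression N x) (\<xi> n)) (\<eta> n)) \<longlonglongrightarrow> (\<Sum>n. cinner (app x (\<xi> n)) (\<eta> n))"
  proof (rule tannerys_theorem[THEN conjunct2, THEN conjunct2])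
    show "((\<lambda>N. cinner (app (compression N x) (\<xi> n)) (\<eta> n)) \<longlongrightarrow> cinner (app x (\<xi> n)) (\<eta> n))
        sequentially" for n
    proof -
      have "(\<lambda>N. app x (trunc N (\<xi> n))) \<longlonglongrightarrow> app x (\<xi> n)"
        by (intro bounded_linear.tendsto[OF app_bounded_linear] trunc_tendsto)
      moreover have bnd: "bounded_bilinear cinner"
        by (rule bounded_bilinear.intro)
          (auto simp: cinner_add_left cinner_add_right scaleR_scaleC cinner_scaleC_left
            cinner_scaleC_right scaleC_complex_def intro!: exI[of _ 1] cinner_bound)
      ultimately show ?thesis
        unfolding app_compression cinner_trunc
        by (intro bounded_bilinear.tendsto[OF bnd] trunc_tendsto)
    qed
    have "norm (cinner (app (compression N x) (\<xi> n)) (\<eta> n)) \<le> K * (norm (\<xi> n) * norm (\<eta> n))" for N n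
    proof -
      have bd: "norm (app (compression N x) (\<xi> n)) \<le> K * norm (\<xi> n)"
        unfolding app_compression
        by (intro order_trans[OF norm_trunc_le] order_trans[OF K(2)] mult_left_mono norm_trunc_le K(1))
      show ?thesis
        using order_trans[OF cinner_bound mult_right_mono[OF bd norm_ge_zero]] by (simp add: mult.assoc)
    qed
    then show "\<forall>\<^sub>F (n, N) in sequentially \<times>\<^sub>F sequentially.
        norm (cinner (app (compression N x) (\<xi> n)) (\<eta> n)) \<le> K * (norm (\<xi> n) * norm (\<eta> n))"
      by (intro always_eventually) auto
    show "summable (\<lambda>n. K * (norm (\<xi> n) * norm (\<eta> n)))"
      by (intro summable_mult summable_norm_mult s)
  qed simp
  then show ?thesis by (simp add: f)
qed

text \<open>Convergence in a generated topology only has to be tested on the generating sets.\<close>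

lemma compression_limitin: "limitin ultraweak_topology (\<lambda>N. compression N x) x sequentially"
  unfolding limitin_def
proof (intro conjI allI impI)
  fix U assume U: "openin ultraweak_topology U \<and> x \<in> U"
  then have "generate_topology_on {f -` V | f V. f \<in> ultraweak_functionals \<and> open V} U"
    by (simp add: ultraweak_topology_def openin_topology_generated_by_iff)
  then have "x \<in> U \<longrightarrow> (\<forall>\<^sub>F N in sequentially. compression N x \<in> U)"
  proof (induction rule: generate_topology_on.induct)
    case (Int a b) then show ?case by (auto intro: eventually_conj)
  next
    case (UN \<K>)
    show ?case
    proof
      assume "x \<in> \<Union>\<K>"
      then obtain k where "k \<in> \<K>" "x \<in> k" by blast
      with UN.IH show "\<forall>\<^sub>F N in sequentially. compression N x \<in> \<Union>\<K>"
        by (blast intro: eventually_mono)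
    qed
  next
    case (Basis s)
    then show ?case
      by (auto intro!: topological_tendstoD[OF compression_ultraweak_tendsto])
  qed simp
  then show "\<forall>\<^sub>F N in sequentially. compression N x \<in> U" using U by blast
qed simp

lemma matrix_coefficient_ultraweak:
  "(\<lambda>x. cinner (app x \<xi>) \<eta>) \<in> ultraweak_functionals"
proof -
  have fin: "summable (\<lambda>n. (norm (if n = 0 then \<zeta> else 0))\<^sup>2)" for \<zeta> :: ell2
    by (rule summable_finite[of "{0::nat}"]) auto
  have "(\<Sum>n. cinner (app x (if n = 0 then \<xi> else 0)) (if n = 0 then \<eta> else 0)) = cinner (app x \<xi>) \<eta>" for x
    by (subst suminf_finite[of "{0::nat}"]) auto
  then show ?thesis
    using ultraweak_functionalsI[of "\<lambda>n. if n = 0 then \<xi> else 0" "\<lambda>n. if n = 0 then \<eta> else 0"] fin by simp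
qed

text \<open>Finite combinations of matrix units are ultraweakly dense, by compression, so two normal linear
  maps that agree on matrix units agree.\<close>

lemma normal_map_ext:
  assumes "clinear A" "normal_map A" "clinear B" "normal_map B"
    and eq: "\<And>m n. A (rank_one (\<e> m) (\<e> n)) = B (rank_one (\<e> m) (\<e> n))"
  shows "A = B"
proof (intro ext bop_eqI_basis)
  fix x n m
  have "A (compression N x) = B (compression N x)" for N
    using assms(1,3) unfolding compression_def
    by (simp add: clinear_sum clinear_iff eq)
  have "(\<lambda>N. cinner (app (T (compression N x)) (\<e> n)) (\<e> m)) \<longlonglongrightarrow> cinner (app (T x) (\<e> n)) (\<e> m)"
    if "normal_map T" for T
  proof -
    have "continuous_map ultraweak_topology euclidean (\<lambda>x. cinner (app x (\<e> n)) (\<e> m))"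
      by (intro continuous_ultraweak_functional matrix_coefficient_ultraweak)
    from continuous_map_compose[OF that[unfolded normal_map_def] this]
    have "continuous_map ultraweak_topology euclidean (\<lambda>x. cinner (app (T x) (\<e> n)) (\<e> m))"
      by (simp add: o_def)
    from continuous_map_limit[OF this compression_limitin[of x]] show ?thesis
      by (simp add: o_def limitin_canonical_iff)
  qed
  from this[OF assms(2)] this[OF assms(4)]
  have "cinner (app (A x) (\<e> n)) (\<e> m) = cinner (app (B x) (\<e> n)) (\<e> m)"
    unfolding \<open>\<And>N. A (compression N x) = B (compression N x)\<close> by (rule LIMSEQ_unique)
  then show "coord (app (A x) (\<e> n)) m = coord (app (B x) (\<e> n)) m"
    by (simp add: cinner_basis_vec_right)
qed

section \<open>Kraus maps\<close>

definition kraus_map :: "'i set \<Rightarrow> ('i \<Rightarrow> bop) \<Rightarrow> bop \<Rightarrow> bop" where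
  "kraus_map I v x = (\<Sum>k\<in>I. adj (v k) * x * v k)"

lemma clinear_sandwich_sum:
  "clinear (\<lambda>x. \<Sum>j\<in>I. \<Sum>k\<in>J. c j k *\<^sub>C (adj (v j) * x * w k))"
  by (simp add: clinear_iff ring_distribs scaleC_add_right sum.distrib scaleC_sum_right
      scaleC_mult_bop scaleC_scaleC mult.commute[of _ "_ :: complex"])

lemma continuous_map_sandwich_functional:
  assumes "f \<in> ultraweak_functionals"
  shows "continuous_map ultraweak_topology euclidean (\<lambda>x. f (c *\<^sub>C (adj y * x * z)))"
proof -
  obtain \<xi> \<eta> where f: "f = (\<lambda>x. \<Sum>n. cinner (app x (\<xi> n)) (\<eta> n))"
    and s: "summable (\<lambda>n. (norm (\<xi> n))\<^sup>2)" "summable (\<lambda>n. (norm (\<eta> n))\<^sup>2)"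
    using assms unfolding ultraweak_functionals_def by blast
  have "f (c *\<^sub>C (adj y * x * z)) = (\<Sum>n. cinner (app x (app z (\<xi> n))) (app (cnj c *\<^sub>C y) (\<eta> n)))" for x
    by (simp add: f cinner_scaleC_left cinner_scaleC_right cinner_adj_left)
  moreover have "continuous_map ultraweak_topology euclidean
      (\<lambda>x. \<Sum>n. cinner (app x (app z (\<xi> n))) (app (cnj c *\<^sub>C y) (\<eta> n)))"
    by (intro continuous_ultraweak_functional ultraweak_functionalsI summable_app s)
  ultimately show ?thesis by simp
qed

lemma ultraweak_functional_sum:
  assumes "f \<in> ultraweak_functionals"
  shows "f (\<Sum>i\<in>I. x i) = (\<Sum>i\<in>I. f (x i))"
proof -
  obtain \<xi> \<eta> where f: "f = (\<lambda>x. \<Sum>n. cinner (app x (\<xi> n)) (\<eta> n))"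
    and s: "summable (\<lambda>n. (norm (\<xi> n))\<^sup>2)" "summable (\<lambda>n. (norm (\<eta> n))\<^sup>2)"
    using assms unfolding ultraweak_functionals_def by blast
  show ?thesis
    by (simp add: f app_sum_left cinner_sum_left suminf_sum summable_cinner_seq summable_app s)
qed

lemma normal_sandwich_sum:
  assumes "finite I" "finite J"
  shows "normal_map (\<lambda>x. \<Sum>j\<in>I. \<Sum>k\<in>J. c j k *\<^sub>C (adj (v j) * x * w k))"
  unfolding normal_map_def
proof (rule continuous_into_ultraweak)
  fix f assume f: "f \<in> ultraweak_functionals"
  show "continuous_map ultraweak_topology euclidean
      (f \<circ> (\<lambda>x. \<Sum>j\<in>I. \<Sum>k\<in>J. c j k *\<^sub>C (adj (v j) * x * w k)))"
    using assms
    by (simp add: o_def ultraweak_functional_sum[OF f])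
      (intro continuous_map_sum continuous_map_sandwich_functional f)
qed

text \<open>Maps of the form \<open>\<Sum>j k. c\<^sub>j\<^sub>k v\<^sub>j\<^sup>* x v\<^sub>k\<close> also arise below as the maps dominated by a Kraus
  map; seeing Kraus maps among them makes one proof of linearity and normality serve for both.\<close>

lemma kraus_map_as_sandwich_sum:
  assumes "finite I"
  shows "kraus_map I v = (\<lambda>x. \<Sum>j\<in>I. \<Sum>k\<in>I. (if j = k then 1 else 0) *\<^sub>C (adj (v j) * x * v k))"
proof
  fix x
  have "(\<Sum>k\<in>I. (if j = k then 1 else 0) *\<^sub>C (adj (v j) * x * v k)) = adj (v j) * x * v j"
    if "j \<in> I" for j
  proof -
    have "(\<Sum>k\<in>I. (if j = k then 1 else 0) *\<^sub>C (adj (v j) * x * v k))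
        = (\<Sum>k\<in>I. if j = k then adj (v j) * x * v k else 0)"
      by (rule sum.cong) (auto simp: scaleC_one)
    then show ?thesis using assms that by simp
  qed
  then show "kraus_map I v x
      = (\<Sum>j\<in>I. \<Sum>k\<in>I. (if j = k then 1 else 0) *\<^sub>C (adj (v j) * x * v k))"
    by (simp add: kraus_map_def)
qed

lemma kraus_map_clinear: "finite I \<Longrightarrow> clinear (kraus_map I v)"
  by (simp only: kraus_map_as_sandwich_sum clinear_sandwich_sum)

lemma kraus_map_normal: "finite I \<Longrightarrow> normal_map (kraus_map I v)"
  by (simp only: kraus_map_as_sandwich_sum normal_sandwich_sum)

lemma sum_nonneg_Reals:
  fixes f :: "'i \<Rightarrow> complex"
  assumes "\<And>i. i \<in> I \<Longrightarrow> f i \<in> \<real>\<^sub>\<ge>\<^sub>0"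
  shows "sum f I \<in> \<real>\<^sub>\<ge>\<^sub>0"
  using assms by (induction I rule: infinite_finite_induct) auto

text \<open>The quadratic form of the amplified image at \<open>\<xi>\<close> is the sum over \<open>k\<close> of the form of the
  original matrix at the vectors \<open>v k \<xi>\<^sub>i\<close>.\<close>

lemma kraus_map_completely_positive: "completely_positive (kraus_map I v)"
  unfolding completely_positive_def pos_matrix_def
proof (intro allI impI)
  fix n and X :: "nat \<Rightarrow> nat \<Rightarrow> bop" and \<xi> :: "nat \<Rightarrow> ell2"
  assume X: "\<forall>\<xi>. (\<Sum>i<n. \<Sum>j<n. cinner (app (X i j) (\<xi> j)) (\<xi> i)) \<in> \<real>\<^sub>\<ge>\<^sub>0"
  have "(\<Sum>i<n. \<Sum>j<n. cinner (app (kraus_map I v (X i j)) (\<xi> j)) (\<xi> i))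
      = (\<Sum>i<n. \<Sum>j<n. \<Sum>k\<in>I. cinner (app (X i j) (app (v k) (\<xi> j))) (app (v k) (\<xi> i)))"
    by (simp add: kraus_map_def app_sum_left cinner_sum_left cinner_adj_left)
  also have "\<dots> = (\<Sum>k\<in>I. \<Sum>i<n. \<Sum>j<n. cinner (app (X i j) (app (v k) (\<xi> j))) (app (v k) (\<xi> i)))"
    by (simp only: sum.swap[where A = "{..<n}" and B = I])
  also have "\<dots> \<in> \<real>\<^sub>\<ge>\<^sub>0"
    by (rule sum_nonneg_Reals) (rule X[rule_format])
  finally show "(\<Sum>i<n. \<Sum>j<n. cinner (app (kraus_map I v (X i j)) (\<xi> j)) (\<xi> i)) \<in> \<real>\<^sub>\<ge>\<^sub>0" .
qed

lemma kraus_map_UCP: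
  assumes "finite I" "(\<Sum>k\<in>I. adj (v k) * v k) = 1"
  shows "kraus_map I v \<in> UCP"
  using assms kraus_map_clinear[OF assms(1)] kraus_map_normal[OF assms(1)]
    kraus_map_completely_positive[of I v]
  by (simp add: UCP_def kraus_map_def[of I v 1])

lemma kraus_map_scale:
  "kraus_map I (\<lambda>k. complex_of_real r *\<^sub>C v k) = r\<^sup>2 *\<^sub>R kraus_map I v"
  by (auto simp: kraus_map_def fun_eq_iff scaleR_fun_def scaleR_scaleC adj_scaleC scaleC_mult_bop
      scaleC_scaleC scaleC_sum_right power2_eq_square)

lemma kraus_map_Plus:
  assumes "finite I" "finite J"
  shows "kraus_map (I <+> J) (case_sum v w) = kraus_map I v + kraus_map J w"
  using assms by (auto simp: kraus_map_def fun_eq_iff sum.Plus)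

text \<open>A convex combination of Kraus maps is again a Kraus map: the square roots of the weights are
  absorbed into the operators, and the two families are joined.\<close>

lemma kraus_map_convex_UCP:
  assumes fin: "finite I" "finite J" and t: "0 \<le> t" "t \<le> 1"
    and v: "(\<Sum>k\<in>I. adj (v k) * v k) = 1" and w: "(\<Sum>k\<in>J. adj (w k) * w k) = 1"
  shows "t *\<^sub>R kraus_map I v + (1 - t) *\<^sub>R kraus_map J w \<in> UCP"
proof -
  define u where "u = case_sum (\<lambda>k. complex_of_real (sqrt t) *\<^sub>C v k)
    (\<lambda>k. complex_of_real (sqrt (1 - t)) *\<^sub>C w k)"
  have eq: "kraus_map (I <+> J) u = t *\<^sub>R kraus_map I v + (1 - t) *\<^sub>R kraus_map J w"
    using t by (simp add: u_def kraus_map_Plus fin kraus_map_scale)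
  have "(\<Sum>k\<in>I <+> J. adj (u k) * u k) = kraus_map (I <+> J) u 1"
    by (simp add: kraus_map_def)
  also have "\<dots> = t *\<^sub>R 1 + (1 - t) *\<^sub>R 1"
    by (simp add: eq scaleR_fun_def kraus_map_def v w)
  also have "\<dots> = 1" by (simp flip: scaleR_add_left)
  finally show ?thesis
    using kraus_map_UCP[of "I <+> J" u] fin by (simp add: eq)
qed

section \<open>Independent Kraus operators and extreme points\<close>

text \<open>The functionals used below are traces against finite-rank operators. They are linear only where
  their defining series are finite, hence linearity relative to a subspace.\<close>

definition csubspace :: "'a::complex_vector set \<Rightarrow> bool" where
  "csubspace W \<longleftrightarrow> 0 \<in> W \<and> (\<forall>x\<in>W. \<forall>y\<in>W. x + y \<in> W) \<and> (\<forall>c. \<forall>x\<in>W. c *\<^sub>C x \<in> W)"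

lemma csubspace_sum:
  assumes "csubspace W" "\<And>i. i \<in> I \<Longrightarrow> w i \<in> W"
  shows "(\<Sum>i\<in>I. c i *\<^sub>C w i) \<in> W"
  using assms(2) by (induction I rule: infinite_finite_induct)
    (use assms(1) in \<open>auto simp: csubspace_def\<close>)

definition clinear_on :: "'a::complex_vector set \<Rightarrow> ('a \<Rightarrow> complex) \<Rightarrow> bool" where
  "clinear_on W L \<longleftrightarrow> (\<forall>x\<in>W. \<forall>y\<in>W. L (x + y) = L x + L y) \<and> (\<forall>c. \<forall>x\<in>W. L (c *\<^sub>C x) = c * L x)"

lemma clinear_on_sum:
  assumes "csubspace W" "clinear_on W L" "\<And>i. i \<in> I \<Longrightarrow> w i \<in> W"
  shows "L (\<Sum>i\<in>I. c i *\<^sub>C w i) = (\<Sum>i\<in>I. c i * L (w i))"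
proof -
  have "L (0 *\<^sub>C 0) = 0 * L 0" using assms(1,2) by (simp only: clinear_on_def csubspace_def)
  then have 0: "L 0 = 0" by simp
  show ?thesis using assms(3)
  proof (induction I rule: infinite_finite_induct)
    case (insert i I)
    have "(\<Sum>i\<in>I. c i *\<^sub>C w i) \<in> W"
      using insert.prems by (intro csubspace_sum assms(1)) auto
    moreover have "c i *\<^sub>C w i \<in> W" using insert.prems assms(1) by (auto simp: csubspace_def)
    ultimately show ?case
      using insert assms(2) by (simp add: clinear_on_def)
  qed (simp_all add: 0)
qed

text \<open>By induction on the family. Subtracting from a vector its components along the dual vectors
  already found makes the earlier functionals vanish; independence provides a vector on which the
  new functional survives this. Rescaled, it is the new dual vector, and it corrects the old ones.\<close>

lemma dual_family_exists:
  assumes "finite I" and W: "csubspace W" and L: "\<And>k. k \<in> I \<Longrightarrow> clinear_on W (L k)"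
    and indep: "\<And>d. (\<And>w. w \<in> W \<Longrightarrow> (\<Sum>k\<in>I. d k * L k w) = 0) \<Longrightarrow> (\<forall>k\<in>I. d k = 0)"
  shows "\<exists>\<omega>. (\<forall>j\<in>I. \<omega> j \<in> W) \<and> (\<forall>i\<in>I. \<forall>j\<in>I. L i (\<omega> j) = (if i = j then 1 else 0))"
  using assms(1) L indep
proof (induction I rule: finite_induct)
  case (insert p I)
  have "\<forall>k\<in>I. d k = 0" if d: "\<And>w. w \<in> W \<Longrightarrow> (\<Sum>k\<in>I. d k * L k w) = 0" for d
  proof -
    have "(\<Sum>k\<in>insert p I. (d(p := 0)) k * L k w) = (\<Sum>k\<in>I. d k * L k w)" for w
      using insert.hyps by (auto intro!: sum.cong)
    then have "\<forall>k\<in>insert p I. (d(p := 0)) k = 0"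
      using d by (intro insert.prems(2)) auto
    then show ?thesis using insert.hyps(2) by (auto split: if_splits)
  qed
  from insert.IH[OF insert.prems(1) this]
  obtain \<omega> where \<omega>W: "\<And>j. j \<in> I \<Longrightarrow> \<omega> j \<in> W"
    and \<omega>: "\<And>i j. i \<in> I \<Longrightarrow> j \<in> I \<Longrightarrow> L i (\<omega> j) = (if i = j then 1 else 0)"
    by auto
\<comment> \<open>The combination of functionals whose value at \<open>w\<close> is \<open>L p\<close> at the corrected vector \<open>\<kappa>\<close>.\<close>
  define d where "d k = (if k = p then 1 else - L p (\<omega> k))" for k
  obtain w where w: "w \<in> W" and ne: "(\<Sum>k\<in>insert p I. d k * L k w) \<noteq> 0"
    using insert.prems(2)[of d] by (auto simp: d_def)
  define \<kappa> where "\<kappa> = w + (\<Sum>i\<in>I. (- L i w) *\<^sub>C \<omega> i)"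
  have sW: "(\<Sum>i\<in>I. (- L i w) *\<^sub>C \<omega> i) \<in> W" by (intro csubspace_sum W \<omega>W)
  then have \<kappa>W: "\<kappa> \<in> W" using w W by (auto simp: \<kappa>_def csubspace_def)
  have L\<kappa>: "L i \<kappa> = L i w - (\<Sum>k\<in>I. L k w * L i (\<omega> k))" if "i \<in> insert p I" for i
  proof -
    have "L i \<kappa> = L i w + L i (\<Sum>k\<in>I. (- L k w) *\<^sub>C \<omega> k)"
      using insert.prems(1)[OF that] w sW by (simp add: clinear_on_def \<kappa>_def)
    then show ?thesis
      using clinear_on_sum[OF W insert.prems(1)[OF that], of I \<omega> "\<lambda>k. - L k w"] \<omega>W
      by (simp add: sum_negf)
  qed
  have 0: "L i \<kappa> = 0" if "i \<in> I" for i
    using that insert.hyps by (simp add: L\<kappa> \<omega> if_distrib cong: if_cong)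
  have "L p \<kappa> = (\<Sum>k\<in>insert p I. d k * L k w)"
  proof -
    have "(\<Sum>k\<in>I. d k * L k w) = - (\<Sum>k\<in>I. L k w * L p (\<omega> k))"
      unfolding sum_negf[symmetric] using insert.hyps by (intro sum.cong) (auto simp: d_def)
    then show ?thesis using insert.hyps by (simp add: L\<kappa> d_def[of p])
  qed
  with ne have p: "L p \<kappa> \<noteq> 0" by simp
  define \<mu> where "\<mu> = inverse (L p \<kappa>) *\<^sub>C \<kappa>"
  have \<mu>W: "\<mu> \<in> W" using \<kappa>W W by (auto simp: \<mu>_def csubspace_def)
  have L\<mu>: "L i \<mu> = (if i = p then 1 else 0)" if "i \<in> insert p I" for i
    using insert.prems(1)[OF that] \<kappa>W p 0 that by (auto simp: \<mu>_def clinear_on_def)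
  define \<omega>' where "\<omega>' j = (if j = p then \<mu> else \<omega> j + (- L p (\<omega> j)) *\<^sub>C \<mu>)" for j
  have "L i (\<omega>' j) = (if i = j then 1 else 0)" if "i \<in> insert p I" "j \<in> insert p I" for i j
  proof (cases "j = p")
    case True
    then show ?thesis using that(1) L\<mu> by (simp add: \<omega>'_def)
  next
    case False
    then have j: "j \<in> I" using that by simp
    have "L i (\<omega>' j) = L i (\<omega> j) - L p (\<omega> j) * L i \<mu>"
      using insert.prems(1)[OF that(1)] \<omega>W[OF j] \<mu>W W False
      by (simp add: \<omega>'_def clinear_on_def csubspace_def)
    then show ?thesis using that(1) L\<mu>[OF that(1)] \<omega>[OF _ j] False by auto
  qed
  moreover have "\<omega>' j \<in> W" if "j \<in> insert p I" for j
    using that \<omega>W \<mu>W W by (auto simp: \<omega>'_def csubspace_def)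
  ultimately show ?case by blast
qed auto

lemma nonneg_Reals_Im: "z \<in> \<real>\<^sub>\<ge>\<^sub>0 \<Longrightarrow> Im z = 0" "z \<in> \<real>\<^sub>\<ge>\<^sub>0 \<Longrightarrow> Re z \<ge> 0"
  by (auto simp: complex_nonneg_Reals_iff)

text \<open>The value of the form at \<open>\<omega> + c \<kappa>\<close> is real-affine in \<open>c\<close> because \<open>\<kappa>\<close> is isotropic. It stays
  nonnegative along the real and the imaginary axis, so its linear part vanishes on both; this
  gives the sum and the difference of the two mixed terms.\<close>

lemma isotropic_imp_orthogonal:
  fixes B :: "'a::complex_vector \<Rightarrow> 'a \<Rightarrow> complex"
  assumes B: "\<And>x y z. B (x + y) z = B x z + B y z" "\<And>x y z. B z (x + y) = B z x + B z y"
    "\<And>c x y. B (c *\<^sub>C x) y = c * B x y" "\<And>c x y. B x (c *\<^sub>C y) = cnj c * B x y"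
    and pos: "\<And>x. B x x \<in> \<real>\<^sub>\<ge>\<^sub>0" and 0: "B \<kappa> \<kappa> = 0"
  shows "B \<kappa> \<omega> = 0" "B \<omega> \<kappa> = 0"
proof -
  have *: "B \<omega> \<omega> + (c * B \<kappa> \<omega> + cnj c * B \<omega> \<kappa>) \<in> \<real>\<^sub>\<ge>\<^sub>0" for c
    using pos[of "\<omega> + c *\<^sub>C \<kappa>"] by (simp add: B 0 algebra_simps)
  have **: "w = 0" if "\<And>r::real. B \<omega> \<omega> + complex_of_real r * w \<in> \<real>\<^sub>\<ge>\<^sub>0" for w
  proof (rule complex_eqI)
    have "r * Im w = 0" for r
      using nonneg_Reals_Im(1)[OF that[of r]] nonneg_Reals_Im(1)[OF pos[of \<omega>]] by simp
    from this[of 1] show "Im w = Im 0" by simp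
    have ge: "Re (B \<omega> \<omega>) + r * Re w \<ge> 0" for r
      using nonneg_Reals_Im(2)[OF that[of r]] by simp
    show "Re w = Re 0"
    proof (rule ccontr)
      assume "\<not> ?thesis"
      then show False using ge[of "- (Re (B \<omega> \<omega>) + 1) / Re w"] by simp
    qed
  qed
  have "B \<kappa> \<omega> + B \<omega> \<kappa> = 0"
    by (rule **) (use *[of "complex_of_real _"] in \<open>simp add: algebra_simps\<close>)
  moreover have "\<i> * B \<kappa> \<omega> - \<i> * B \<omega> \<kappa> = 0"
    by (rule **) (use *[of "\<i> * complex_of_real _"] in \<open>simp add: algebra_simps\<close>)
  ultimately show "B \<kappa> \<omega> = 0" "B \<omega> \<kappa> = 0"
    by (auto simp: add_eq_0_iff)
qed

text \<open>The sesquilinear form of the \<open>N \<times> N\<close> corner of the Choi matrix, whose entries are the images of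
  the matrix units, at the vectors with components \<open>\<omega> (\<e> j)\<close>. Using an operator \<open>\<omega>\<close> to collect the
  components lets one argument serve for all \<open>N\<close> at once.\<close>

definition choi_form :: "nat \<Rightarrow> (bop \<Rightarrow> bop) \<Rightarrow> bop \<Rightarrow> bop \<Rightarrow> complex" where
  "choi_form N A \<omega> \<omega>' =
    (\<Sum>i<N. \<Sum>j<N. cinner (app (A (rank_one (\<e> i) (\<e> j))) (app \<omega> (\<e> j))) (app \<omega>' (\<e> i)))"

lemma choi_form_linear:
  "choi_form N A (x + y) z = choi_form N A x z + choi_form N A y z"
  "choi_form N A z (x + y) = choi_form N A z x + choi_form N A z y"
  "choi_form N A (c *\<^sub>C x) y = c * choi_form N A x y"
  "choi_form N A x (c *\<^sub>C y) = cnj c * choi_form N A x y"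
  by (simp_all add: choi_form_def app_linear cinner_add_left cinner_add_right sum.distrib
      cinner_scaleC_left cinner_scaleC_right sum_distrib_left)

lemma choi_form_sum:
  "choi_form N A (\<Sum>i\<in>I. c i *\<^sub>C w i) z = (\<Sum>i\<in>I. c i * choi_form N A (w i) z)"
  "choi_form N A z (\<Sum>i\<in>I. c i *\<^sub>C w i) = (\<Sum>i\<in>I. cnj (c i) * choi_form N A z (w i))"
proof -
  have 0: "choi_form N A 0 z = 0" "choi_form N A z 0 = 0" by (simp_all add: choi_form_def)
  show "choi_form N A (\<Sum>i\<in>I. c i *\<^sub>C w i) z = (\<Sum>i\<in>I. c i * choi_form N A (w i) z)"
    by (induction I rule: infinite_finite_induct) (simp_all add: 0 choi_form_linear)
  show "choi_form N A z (\<Sum>i\<in>I. c i *\<^sub>C w i) = (\<Sum>i\<in>I. cnj (c i) * choi_form N A z (w i))"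
    by (induction I rule: infinite_finite_induct) (simp_all add: 0 choi_form_linear)
qed

lemma choi_form_cutoff:
  assumes "N \<le> M" "\<And>n. n \<ge> N \<Longrightarrow> app \<omega> (\<e> n) = 0" "\<And>n. n \<ge> N \<Longrightarrow> app \<omega>' (\<e> n) = 0"
  shows "choi_form M A \<omega> \<omega>' = choi_form N A \<omega> \<omega>'"
proof -
  have "choi_form M A \<omega> \<omega>' =
      (\<Sum>i<N. \<Sum>j<M. cinner (app (A (rank_one (\<e> i) (\<e> j))) (app \<omega> (\<e> j))) (app \<omega>' (\<e> i)))"
    unfolding choi_form_def using assms by (intro sum.mono_neutral_right) auto
  also have "\<dots> = choi_form N A \<omega> \<omega>'"
    unfolding choi_form_def using assms by (intro sum.cong sum.mono_neutral_right) auto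
  finally show ?thesis .
qed

text \<open>The matrix of matrix units is positive: its form at \<open>\<xi>\<close> is the squared modulus of
  \<open>\<Sum>j. coord (\<xi> j) j\<close>.\<close>

lemma choi_form_nonneg:
  assumes "completely_positive A"
  shows "choi_form N A \<omega> \<omega> \<in> \<real>\<^sub>\<ge>\<^sub>0"
proof -
  have "pos_matrix N (\<lambda>i j. rank_one (\<e> i) (\<e> j))"
    unfolding pos_matrix_def
  proof
    fix \<xi> :: "nat \<Rightarrow> ell2"
    define s where "s = (\<Sum>j<N. coord (\<xi> j) j)"
    have "(\<Sum>i<N. \<Sum>j<N. cinner (app (rank_one (\<e> i) (\<e> j)) (\<xi> j)) (\<xi> i)) = s * cnj s"
      unfolding s_def cnj_sum sum_product
      by (subst sum.swap) (simp add: cinner_basis_vec_left cinner_basis_vec_right cinner_scaleC_left)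
    also have "\<dots> \<in> \<real>\<^sub>\<ge>\<^sub>0"
      by (simp add: complex_norm_square[symmetric] complex_nonneg_Reals_iff del: of_real_power)
    finally show "(\<Sum>i<N. \<Sum>j<N. cinner (app (rank_one (\<e> i) (\<e> j)) (\<xi> j)) (\<xi> i)) \<in> \<real>\<^sub>\<ge>\<^sub>0" .
  qed
  then have "pos_matrix N (\<lambda>i j. A (rank_one (\<e> i) (\<e> j)))"
    using assms by (simp add: completely_positive_def)
  then show ?thesis by (simp add: pos_matrix_def choi_form_def)
qed

text \<open>Every Kraus operator contributes one squared functional, the truncated trace of \<open>v k \<omega>\<close>. The
  Choi form of a Kraus map with finitely many operators thus has finite rank.\<close>

lemma choi_form_kraus_map:
  "choi_form N (kraus_map I v) \<omega> \<omega>' =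
    (\<Sum>k\<in>I. (\<Sum>n<N. coord (app (v k) (app \<omega> (\<e> n))) n) *
            cnj (\<Sum>n<N. coord (app (v k) (app \<omega>' (\<e> n))) n))"
proof -
  have "choi_form N (kraus_map I v) \<omega> \<omega>' =
    (\<Sum>i<N. \<Sum>j<N. \<Sum>k\<in>I. coord (app (v k) (app \<omega> (\<e> j))) j * cnj (coord (app (v k) (app \<omega>' (\<e> i))) i))"
    by (simp add: choi_form_def kraus_map_def app_sum_left cinner_sum_left cinner_adj_left
        app_linear cinner_scaleC_left cinner_basis_vec_left cinner_basis_vec_right)
  also have "\<dots> = (\<Sum>k\<in>I. \<Sum>i<N. \<Sum>j<N.
      coord (app (v k) (app \<omega> (\<e> j))) j * cnj (coord (app (v k) (app \<omega>' (\<e> i))) i))"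
    by (simp only: sum.swap[where A = "{..<N}" and B = I])
  also have "\<dots> = (\<Sum>k\<in>I. (\<Sum>n<N. coord (app (v k) (app \<omega> (\<e> n))) n) *
            cnj (\<Sum>n<N. coord (app (v k) (app \<omega>' (\<e> n))) n))"
    unfolding cnj_sum sum_product by (intro sum.cong refl sum.swap)
  finally show ?thesis .
qed

lemma choi_form_matrix_unit:
  assumes "m < N" "n < N"
  shows "choi_form N A (rank_one (\<e> p) (\<e> n)) (rank_one (\<e> q) (\<e> m))
    = cinner (app (A (rank_one (\<e> m) (\<e> n))) (\<e> p)) (\<e> q)"
proof -
  have unit: "app (rank_one (\<e> r) (\<e> k)) (\<e> l) = (if l = k then \<e> r else 0)" for k l r
    by (simp add: cinner_basis_vec_right coord_basis_vec scaleC_one)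
  have "choi_form N A (rank_one (\<e> p) (\<e> n)) (rank_one (\<e> q) (\<e> m)) =
    (\<Sum>i<N. \<Sum>j<N. if j = n then
      if i = m then cinner (app (A (rank_one (\<e> i) (\<e> j))) (\<e> p)) (\<e> q) else 0 else 0)"
    unfolding choi_form_def unit by (intro sum.cong refl) simp
  then show ?thesis using assms by simp
qed

text \<open>A Radon-Nikodym theorem. The Choi form of \<open>A\<close> vanishes on the common kernel of the trace
  functionals \<open>L k\<close>, since the form of the Kraus map does; being positive, it then factors through
  these functionals in both arguments. Independence of the operators \<open>v k\<close> gives finite-rank
  operators dual to the functionals, and the coefficients \<open>c\<close> are the values of the form at those.
  Evaluating the form at matrix units recovers \<open>A\<close>.\<close>

lemma dominated_by_kraus_map:
  assumes fin: "finite I"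
    and indep: "\<And>d. (\<Sum>k\<in>I. d k *\<^sub>C v k) = 0 \<Longrightarrow> \<forall>k\<in>I. d k = 0"
    and A: "completely_positive A"
    and dom: "\<And>N \<omega>. choi_form N (kraus_map I v) \<omega> \<omega> = 0 \<Longrightarrow> choi_form N A \<omega> \<omega> = 0"
  shows "\<exists>c. \<forall>m n. A (rank_one (\<e> m) (\<e> n))
    = (\<Sum>j\<in>I. \<Sum>k\<in>I. c j k *\<^sub>C (adj (v j) * rank_one (\<e> m) (\<e> n) * v k))"
proof -
\<comment> \<open>Operators with finitely many nonzero columns, on which the traces \<open>L k\<close> are finite sums.\<close>
  define W where "W = {\<omega>. \<forall>\<^sub>F n in sequentially. app \<omega> (\<e> n) = 0}"
  define L where "L k \<omega> = (\<Sum>n. coord (app (v k) (app \<omega> (\<e> n))) n)" for k \<omega>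
  have W: "csubspace W"
    unfolding csubspace_def W_def by (auto elim: eventually_elim2 eventually_mono)
  have L: "L k \<omega> = (\<Sum>n<N. coord (app (v k) (app \<omega> (\<e> n))) n)"
    if "\<And>n. n \<ge> N \<Longrightarrow> app \<omega> (\<e> n) = 0" for k \<omega> N
    unfolding L_def by (rule suminf_finite) (use that in \<open>auto simp: not_less\<close>)
  have L_linear: "clinear_on W (L k)" for k
    unfolding clinear_on_def
  proof (intro conjI ballI allI)
    fix x y assume "x \<in> W" "y \<in> W"
    then have "\<forall>\<^sub>F n in sequentially. app x (\<e> n) = 0 \<and> app y (\<e> n) = 0"
      by (simp add: W_def eventually_conj)
    then obtain N where "\<And>n. n \<ge> N \<Longrightarrow> app x (\<e> n) = 0 \<and> app y (\<e> n) = 0"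
      unfolding eventually_sequentially by blast
    then show "L k (x + y) = L k x + L k y"
      by (simp add: L[of N] app_linear sum.distrib)
  next
    fix c x assume "x \<in> W"
    then obtain N where "\<And>n. n \<ge> N \<Longrightarrow> app x (\<e> n) = 0"
      unfolding W_def eventually_sequentially by blast
    then show "L k (c *\<^sub>C x) = c * L k x"
      by (simp add: L[of N] app_linear sum_distrib_left)
  qed
  have unit_zero: "app (rank_one (\<e> m) (\<e> n)) (\<e> i) = 0" if "i \<ge> Suc n" for m n i
    using that by (simp add: cinner_basis_vec_right coord_basis_vec)
  then have unit_W: "rank_one (\<e> m) (\<e> n) \<in> W" for m n
    unfolding W_def eventually_sequentially by blast
  have L_unit: "L k (rank_one (\<e> m) (\<e> n)) = coord (app (v k) (\<e> m)) n" for k m n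
  proof -
    have "L k (rank_one (\<e> m) (\<e> n))
        = (\<Sum>i<Suc n. coord (app (v k) (app (rank_one (\<e> m) (\<e> n)) (\<e> i))) i)"
      by (rule L) (rule unit_zero)
    also have "\<dots> = (\<Sum>i<Suc n. if i = n then coord (app (v k) (\<e> m)) i else 0)"
      by (intro sum.cong refl) (simp add: cinner_basis_vec_right coord_basis_vec scaleC_one)
    finally show ?thesis by simp
  qed
  have indep_L: "\<forall>k\<in>I. d k = 0" if d: "\<And>w. w \<in> W \<Longrightarrow> (\<Sum>k\<in>I. d k * L k w) = 0" for d
  proof (rule indep, rule bop_eqI_basis)
    fix n m
    show "coord (app (\<Sum>k\<in>I. d k *\<^sub>C v k) (\<e> n)) m = coord (app 0 (\<e> n)) m"
      using d[OF unit_W[of n m]] by (simp add: L_unit app_sum_left)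
  qed
  have "\<exists>\<omega>. (\<forall>j\<in>I. \<omega> j \<in> W) \<and> (\<forall>i\<in>I. \<forall>j\<in>I. L i (\<omega> j) = (if i = j then 1 else 0))"
    by (rule dual_family_exists[OF fin W L_linear]) (rule indep_L)
  then obtain \<omega> where \<omega>W: "\<And>j. j \<in> I \<Longrightarrow> \<omega> j \<in> W"
    and \<omega>: "\<And>i j. i \<in> I \<Longrightarrow> j \<in> I \<Longrightarrow> L i (\<omega> j) = (if i = j then 1 else 0)"
    by auto
  have "\<forall>\<^sub>F n in sequentially. \<forall>j\<in>I. app (\<omega> j) (\<e> n) = 0"
    using \<omega>W by (intro eventually_ball_finite fin) (auto simp: W_def)
  then obtain N0 where N0: "\<And>n j. n \<ge> N0 \<Longrightarrow> j \<in> I \<Longrightarrow> app (\<omega> j) (\<e> n) = 0"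
    unfolding eventually_sequentially by blast
  define c where "c j k = choi_form N0 A (\<omega> k) (\<omega> j)" for j k
  have expand: "choi_form N A \<tau> \<sigma> = (\<Sum>k\<in>I. L k \<tau> * choi_form N A (\<omega> k) \<sigma>)"
    "choi_form N A \<sigma> \<tau> = (\<Sum>k\<in>I. cnj (L k \<tau>) * choi_form N A \<sigma> (\<omega> k))"
    if N: "N \<ge> N0" and \<tau>: "\<And>n. n \<ge> N \<Longrightarrow> app \<tau> (\<e> n) = 0" for N \<tau> \<sigma>
  proof -
\<comment> \<open>The part of \<open>\<tau>\<close> in the common kernel of the functionals.\<close>
    define \<kappa> where "\<kappa> = \<tau> + (\<Sum>k\<in>I. (- L k \<tau>) *\<^sub>C \<omega> k)"
    have \<tau>W: "\<tau> \<in> W" using \<tau> unfolding W_def eventually_sequentially by blast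
    have sW: "(\<Sum>k\<in>I. (- L k \<tau>) *\<^sub>C \<omega> k) \<in> W" by (intro csubspace_sum W \<omega>W)
    have "app (\<Sum>k\<in>I. (- L k \<tau>) *\<^sub>C \<omega> k) (\<e> n) = 0" if "n \<ge> N" for n
      using N0 N that by (simp add: app_sum_left ell2_eqI)
    then have \<kappa>0: "app \<kappa> (\<e> n) = 0" if "n \<ge> N" for n
      using \<tau> that by (simp add: \<kappa>_def)
    have "L i \<kappa> = 0" if "i \<in> I" for i
    proof -
      have "L i \<kappa> = L i \<tau> + (\<Sum>k\<in>I. - L k \<tau> * L i (\<omega> k))"
        using L_linear[of i] \<tau>W sW clinear_on_sum[OF W L_linear[of i], where I = I and w = \<omega> and c = "\<lambda>k. - L k \<tau>"] \<omega>W
        by (simp add: clinear_on_def \<kappa>_def)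
      also have "(\<Sum>k\<in>I. - L k \<tau> * L i (\<omega> k)) = (\<Sum>k\<in>I. if i = k then - L k \<tau> else 0)"
        using that by (intro sum.cong) (auto simp: \<omega>)
      finally show ?thesis using that fin by simp
    qed
    moreover have "(\<Sum>n<N. coord (app (v k) (app \<kappa> (\<e> n))) n) = L k \<kappa>" for k
      by (rule L[symmetric]) (rule \<kappa>0)
    ultimately have "choi_form N (kraus_map I v) \<kappa> \<kappa> = 0"
      unfolding choi_form_kraus_map by simp
    then have "choi_form N A \<kappa> \<kappa> = 0" by (rule dom)
    note orth = isotropic_imp_orthogonal[of "choi_form N A", OF choi_form_linear
        choi_form_nonneg[OF A] this, of \<sigma>]
    show "choi_form N A \<tau> \<sigma> = (\<Sum>k\<in>I. L k \<tau> * choi_form N A (\<omega> k) \<sigma>)"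
      using orth(1) by (simp add: \<kappa>_def choi_form_linear choi_form_sum sum_negf)
    show "choi_form N A \<sigma> \<tau> = (\<Sum>k\<in>I. cnj (L k \<tau>) * choi_form N A \<sigma> (\<omega> k))"
      using orth(2) by (simp add: \<kappa>_def choi_form_linear choi_form_sum sum_negf)
  qed
  have "A (rank_one (\<e> m) (\<e> n))
      = (\<Sum>j\<in>I. \<Sum>k\<in>I. c j k *\<^sub>C (adj (v j) * rank_one (\<e> m) (\<e> n) * v k))" for m n
  proof (rule bop_eqI_basis)
    fix p q
    define N where "N = Max {N0, Suc m, Suc n}"
    have N: "N \<ge> N0" "N \<ge> Suc m" "N \<ge> Suc n" by (simp_all add: N_def)
    have "coord (app (A (rank_one (\<e> m) (\<e> n))) (\<e> p)) q
        = choi_form N A (rank_one (\<e> p) (\<e> n)) (rank_one (\<e> q) (\<e> m))"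
      using N by (subst choi_form_matrix_unit) (simp_all add: cinner_basis_vec_right)
    also have "\<dots> = (\<Sum>k\<in>I. coord (app (v k) (\<e> p)) n *
        choi_form N A (\<omega> k) (rank_one (\<e> q) (\<e> m)))"
      using N by (subst expand(1)) (simp_all add: unit_zero L_unit del: app_rank_one)
    also have "\<dots> = (\<Sum>k\<in>I. coord (app (v k) (\<e> p)) n *
        (\<Sum>j\<in>I. cnj (coord (app (v j) (\<e> q)) m) * choi_form N A (\<omega> k) (\<omega> j)))"
      using N by (subst expand(2)) (simp_all add: unit_zero L_unit del: app_rank_one)
    also have "\<dots> = (\<Sum>k\<in>I. coord (app (v k) (\<e> p)) n *
        (\<Sum>j\<in>I. cnj (coord (app (v j) (\<e> q)) m) * c j k))"
      unfolding c_def using choi_form_cutoff[OF N(1)] N0 by (intro sum.cong refl arg_cong2[of _ _ _ _ "(*)"]) auto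
    also have "\<dots> = (\<Sum>j\<in>I. \<Sum>k\<in>I. c j k *
        (coord (app (v k) (\<e> p)) n * cnj (coord (app (v j) (\<e> q)) m)))"
      unfolding sum_distrib_left by (subst sum.swap) (simp add: ac_simps)
    also have "\<dots> = coord (app (\<Sum>j\<in>I. \<Sum>k\<in>I. c j k *\<^sub>C
        (adj (v j) * rank_one (\<e> m) (\<e> n) * v k)) (\<e> p)) q"
      by (simp add: app_sum_left coord_adj cinner_basis_vec_right cinner_scaleC_left
          cinner_basis_vec_left app_linear)
    finally show "coord (app (A (rank_one (\<e> m) (\<e> n))) (\<e> p)) q = \<dots>" .
  qed
  then show ?thesis by blast
qed

text \<open>If the map is a proper convex combination of \<open>A\<close> and \<open>B\<close>, positivity of both Choi forms makes
  that of \<open>A\<close> vanish wherever that of the map does, so \<open>A\<close> is a combination of the maps \<open>v\<^sub>j\<^sup>* x v\<^sub>k\<close>. Both maps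
  are unital, and independence of the products \<open>v\<^sub>j\<^sup>* v\<^sub>k\<close> leaves only the coefficients
  of the Kraus map itself.\<close>

theorem kraus_map_extreme_point:
  assumes fin: "finite I" and unital: "(\<Sum>k\<in>I. adj (v k) * v k) = 1"
    and indep: "\<And>c. (\<Sum>j\<in>I. \<Sum>k\<in>I. c j k *\<^sub>C (adj (v j) * v k)) = 0 \<Longrightarrow> \<forall>j\<in>I. \<forall>k\<in>I. c j k = 0"
  shows "kraus_map I v extreme_point_of UCP"
proof -
  let ?T = "kraus_map I v"
\<comment> \<open>A relation among the operators \<open>v k\<close> would give one among the products.\<close>
  have indep_v: "\<forall>k\<in>I. d k = 0" if d: "(\<Sum>k\<in>I. d k *\<^sub>C v k) = 0" for d
  proof -
    have "(\<Sum>k\<in>I. d k *\<^sub>C (adj (v j) * v k)) = adj (v j) * (\<Sum>k\<in>I. d k *\<^sub>C v k)" for j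
      by (simp add: sum_distrib_left scaleC_mult_bop)
    then have "(\<Sum>j\<in>I. \<Sum>k\<in>I. d k *\<^sub>C (adj (v j) * v k)) = 0" by (simp add: d)
    from indep[OF this] show ?thesis by blast
  qed
  have False if A: "A \<in> UCP" and B: "B \<in> UCP" and T: "?T \<in> open_segment A B" for A B
  proof -
    obtain u where u: "0 < u" "u < 1" and T_eq: "?T = (1 - u) *\<^sub>R A + u *\<^sub>R B"
      using T by (auto simp: in_segment)
    have form: "choi_form N ?T \<omega> \<omega> = complex_of_real (1 - u) * choi_form N A \<omega> \<omega>
        + complex_of_real u * choi_form N B \<omega> \<omega>" for N \<omega>
      unfolding T_eq choi_form_def
      by (simp add: scaleR_fun_def scaleR_scaleC cinner_add_left cinner_scaleC_left sum.distrib
          sum_distrib_left)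
    have dom: "choi_form N A \<omega> \<omega> = 0" if "choi_form N ?T \<omega> \<omega> = 0" for N \<omega>
    proof -
      have nn: "choi_form N A \<omega> \<omega> \<in> \<real>\<^sub>\<ge>\<^sub>0" "choi_form N B \<omega> \<omega> \<in> \<real>\<^sub>\<ge>\<^sub>0"
        using A B by (auto simp: UCP_def intro: choi_form_nonneg)
      have "(1 - u) * Re (choi_form N A \<omega> \<omega>) + u * Re (choi_form N B \<omega> \<omega>) = 0"
        using arg_cong[OF form[of N \<omega>], of Re] that by simp
      moreover have "(1 - u) * Re (choi_form N A \<omega> \<omega>) \<ge> 0" "u * Re (choi_form N B \<omega> \<omega>) \<ge> 0"
        using nn u by (auto simp: complex_nonneg_Reals_iff)
      ultimately have "(1 - u) * Re (choi_form N A \<omega> \<omega>) = 0" by linarith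
      with u nn show ?thesis by (auto simp: complex_nonneg_Reals_iff complex_eq_iff)
    qed
    obtain c where c: "\<And>m n. A (rank_one (\<e> m) (\<e> n))
        = (\<Sum>j\<in>I. \<Sum>k\<in>I. c j k *\<^sub>C (adj (v j) * rank_one (\<e> m) (\<e> n) * v k))"
      using dominated_by_kraus_map[OF fin indep_v _ dom] A unfolding UCP_def by blast
    have A_eq: "A = (\<lambda>x. \<Sum>j\<in>I. \<Sum>k\<in>I. c j k *\<^sub>C (adj (v j) * x * v k))"
      using A c by (intro normal_map_ext clinear_sandwich_sum normal_sandwich_sum fin) (auto simp: UCP_def)
    have "(\<Sum>j\<in>I. \<Sum>k\<in>I. c j k *\<^sub>C (adj (v j) * 1 * v k)) = A 1" by (simp add: A_eq)
    also have "\<dots> = ?T 1" using A unital by (simp add: UCP_def kraus_map_def)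
    also have "\<dots> = (\<Sum>j\<in>I. \<Sum>k\<in>I. (if j = k then 1 else 0) *\<^sub>C (adj (v j) * 1 * v k))"
      by (simp only: kraus_map_as_sandwich_sum[OF fin])
    finally have "(\<Sum>j\<in>I. \<Sum>k\<in>I. (c j k - (if j = k then 1 else 0)) *\<^sub>C (adj (v j) * v k)) = 0"
    proof -
      assume eq: "(\<Sum>j\<in>I. \<Sum>k\<in>I. c j k *\<^sub>C (adj (v j) * 1 * v k))
        = (\<Sum>j\<in>I. \<Sum>k\<in>I. (if j = k then 1 else 0) *\<^sub>C (adj (v j) * 1 * v k))"
      have "(a - b) *\<^sub>C x = a *\<^sub>C x - b *\<^sub>C x" for a b and x :: bop
        using scaleC_add_left[of "a - b" b x] by simp
      with eq show ?thesis by (simp add: sum_subtractf)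
    qed
    from indep[OF this] have "c j k = (if j = k then 1 else 0)" if "j \<in> I" "k \<in> I" for j k
      using that by auto
    then have "A = ?T"
      unfolding A_eq kraus_map_as_sandwich_sum[OF fin] by (intro ext sum.cong refl) simp
    then show False using T by (simp add: open_segment_def)
  qed
  then show ?thesis
    unfolding extreme_point_of_def using kraus_map_UCP[OF fin unital] by blast
qed

section \<open>States\<close>

text \<open>The functional \<open>y \<mapsto> \<langle>y \<eta>, \<eta>\<rangle>\<close>.\<close>

definition vector_state :: "complex ^ 2 \<Rightarrow> complex ^ 2 ^ 2 \<Rightarrow> complex" where
  "vector_state \<eta> y = (\<Sum>i\<in>UNIV. \<Sum>j\<in>UNIV. y $ i $ j * \<eta> $ j * cnj (\<eta> $ i))"

definition unit_vector :: "complex ^ 2 \<Rightarrow> bool" where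
  "unit_vector \<eta> \<longleftrightarrow> \<eta> $ 1 * cnj (\<eta> $ 1) + \<eta> $ 2 * cnj (\<eta> $ 2) = 1"

lemma vector_state_in_states:
  assumes "unit_vector \<eta>"
  shows "vector_state \<eta> \<in> states"
proof -
  have "vector_state \<eta> (conj_transpose y ** y) \<in> \<real>\<^sub>\<ge>\<^sub>0" for y
  proof -
    have "vector_state \<eta> (conj_transpose y ** y)
      = (\<Sum>k\<in>UNIV. (y $ k $ 1 * \<eta> $ 1 + y $ k $ 2 * \<eta> $ 2) * cnj (y $ k $ 1 * \<eta> $ 1 + y $ k $ 2 * \<eta> $ 2))"
      by (simp add: vector_state_def matrix_matrix_mult_def conj_transpose_def sum_2 algebra_simps)
    also have "\<dots> \<in> \<real>\<^sub>\<ge>\<^sub>0"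
      by (intro sum_nonneg_Reals)
        (simp add: complex_norm_square[symmetric] complex_nonneg_Reals_iff
          del: of_real_power complex_cnj_add complex_cnj_mult)
    finally show ?thesis .
  qed
  moreover have "clinear (vector_state \<eta>)"
    by (simp add: clinear_iff vector_state_def sum_2 scaleC_vec_def scaleC_complex_def algebra_simps)
  moreover have "vector_state \<eta> (mat 1) = 1"
    using assms by (simp add: vector_state_def unit_vector_def sum_2 mat_def)
  ultimately show ?thesis by (simp add: states_def)
qed

lemma psi_plus_vector_state: "psi_plus = vector_state (vector [1, 0])"
  by (simp add: fun_eq_iff psi_plus_def vector_state_def sum_2)

lemma unit_vector_1_0: "unit_vector (vector [1, 0])"
  by (simp add: unit_vector_def)

lemma clinear_matrix_expand:
  assumes "clinear \<psi>"
  shows "\<psi> y = y $ 1 $ 1 * \<psi> (matrix_unit 1 1) + y $ 1 $ 2 * \<psi> (matrix_unit 1 2)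
    + y $ 2 $ 1 * \<psi> (matrix_unit 2 1) + y $ 2 $ 2 * \<psi> (matrix_unit 2 2)"
  using arg_cong[OF matrix_unit_expand[of y], of \<psi>] assms
  by (simp only: clinear_sum[OF assms]) (simp add: clinear_iff scaleC_complex_def sum_2)

lemma state_trace:
  assumes "\<psi> \<in> states"
  shows "\<psi> (matrix_unit 2 2) = 1 - \<psi> (matrix_unit 1 1)"
  using assms clinear_matrix_expand[of \<psi> "mat 1"]
  by (simp add: states_def mat_def algebra_simps)

text \<open>Positivity at \<open>y\<^sup>* y\<close>, where \<open>y\<close> has first row \<open>(x, w)\<close> and second row zero.\<close>

lemma state_quadratic_form:
  assumes "\<psi> \<in> states"
  shows "cnj x * x * \<psi> (matrix_unit 1 1) + cnj x * w * \<psi> (matrix_unit 1 2)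
    + cnj w * x * \<psi> (matrix_unit 2 1) + cnj w * w * \<psi> (matrix_unit 2 2) \<in> \<real>\<^sub>\<ge>\<^sub>0"
proof -
  define y :: "complex ^ 2 ^ 2" where "y = vector [vector [x, w], vector [0, 0]]"
  have "\<psi> (conj_transpose y ** y) \<in> \<real>\<^sub>\<ge>\<^sub>0" "clinear \<psi>" using assms by (auto simp: states_def)
  then show ?thesis
    by (subst (asm) clinear_matrix_expand)
      (simp_all add: y_def matrix_matrix_mult_def conj_transpose_def sum_2)
qed

text \<open>In the density matrix with diagonal \<open>p\<close>, \<open>q\<close> and off-diagonal entry \<open>z\<close>, subtracting the Schur
  complement \<open>p - (cmod z)\<^sup>2 / q\<close> from the upper-left entry leaves a matrix of rank one, while the
  Schur complement itself is a multiple of \<open>psi_plus\<close>. If \<open>q = 0\<close>, positivity forces \<open>z = 0\<close> and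
  the state is \<open>psi_plus\<close>.\<close>

lemma state_decomposition:
  assumes \<psi>: "\<psi> \<in> states" and ne: "\<psi> \<noteq> psi_plus"
  obtains t \<eta> where "0 < t" "t \<le> 1" "unit_vector \<eta>" "\<eta> $ 2 \<noteq> 0"
    "\<psi> = t *\<^sub>R vector_state \<eta> + (1 - t) *\<^sub>R psi_plus"
proof -
  define z where "z = \<psi> (matrix_unit 1 2)"
  note Q = state_quadratic_form[OF \<psi>]
  have "\<psi> (matrix_unit 1 1) \<in> \<real>\<^sub>\<ge>\<^sub>0" "\<psi> (matrix_unit 2 2) \<in> \<real>\<^sub>\<ge>\<^sub>0"
    using Q[of 1 0] Q[of 0 1] by simp_all
  then obtain p q where p: "\<psi> (matrix_unit 1 1) = complex_of_real p" "p \<ge> 0"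
    and q: "\<psi> (matrix_unit 2 2) = complex_of_real q" "q \<ge> 0"
    by (auto simp: nonneg_Reals_def)
  have pq: "p + q = 1"
    using state_trace[OF \<psi>] unfolding p q by (metis add_diff_cancel_left' diff_add_cancel of_real_1 of_real_diff of_real_eq_iff)
  have z': "\<psi> (matrix_unit 2 1) = cnj z"
    using nonneg_Reals_Im(1)[OF Q[of 1 1]] nonneg_Reals_Im(1)[OF Q[of 1 \<i>]]
    by (simp add: p q z_def complex_eq_iff)
  have form: "p + 2 * Re (w * z) + (cmod w)\<^sup>2 * q \<ge> 0" for w
  proof -
    have "Re (cnj w * w) = (cmod w)\<^sup>2"
      by (metis complex_norm_square mult.commute Re_complex_of_real of_real_power)
    moreover have "Re (cnj w * w * complex_of_real q) = Re (cnj w * w) * q" by simp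
    ultimately show ?thesis
      using nonneg_Reals_Im(2)[OF Q[of 1 w]] by (simp add: p q z' flip: z_def)
  qed
  have expand: "\<psi> y = y $ 1 $ 1 * complex_of_real p + y $ 1 $ 2 * z + y $ 2 $ 1 * cnj z
      + y $ 2 $ 2 * complex_of_real q" for y
    using clinear_matrix_expand[of \<psi> y] \<psi> by (simp add: states_def p q z' flip: z_def)
  have zz: "Re (cnj z * z) = (cmod z)\<^sup>2"
    by (metis complex_norm_square mult.commute Re_complex_of_real of_real_power)
  have "q \<noteq> 0"
  proof
    assume q0: "q = 0"
    have "z = 0"
    proof (rule ccontr)
      assume "z \<noteq> 0"
      then have pos: "(cmod z)\<^sup>2 > 0" by simp
\<comment> \<open>With \<open>q = 0\<close> the form is affine in \<open>w\<close>; this multiple of \<open>cnj z\<close> makes it equal to \<open>- 1\<close>.\<close>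
      define r where "r = (p + 1) / (2 * (cmod z)\<^sup>2)"
      have "Re (- (complex_of_real r * cnj z) * z) = - (r * Re (cnj z * z))"
        by (simp add: algebra_simps)
      then have "p - 2 * (r * (cmod z)\<^sup>2) \<ge> 0"
        using form[of "- (complex_of_real r * cnj z)"] q0 zz by simp
      then show False using pos by (simp add: r_def)
    qed
    then have "\<psi> = psi_plus"
      using expand q0 pq by (simp add: fun_eq_iff psi_plus_def)
    then show False using ne by simp
  qed
  then have q0: "q > 0" using q by simp
  define t where "t = q + (cmod z)\<^sup>2 / q"
  have t0: "t > 0" using q0 by (auto simp: t_def intro: add_pos_nonneg)
  have t1: "t \<le> 1"
  proof -
\<comment> \<open>The minimiser of the quadratic form; its minimum is the Schur complement.\<close>
    define w where "w = - (complex_of_real (1 / q) * cnj z)"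
    have "Re (w * z) = - (Re (cnj z * z) / q)"
      by (simp add: w_def field_simps)
    moreover have "(cmod w)\<^sup>2 * q = (cmod z)\<^sup>2 / q"
      using q0 by (simp add: w_def norm_mult norm_divide power_divide power2_eq_square)
    ultimately have "p - 2 * ((cmod z)\<^sup>2 / q) + (cmod z)\<^sup>2 / q \<ge> 0"
      using form[of w] unfolding zz by linarith
    then show ?thesis using pq by (simp add: t_def)
  qed
  define \<eta> :: "complex ^ 2" where
    "\<eta> = vector [cnj z / complex_of_real (sqrt q * sqrt t), complex_of_real (sqrt q / sqrt t)]"
  have sq: "complex_of_real (sqrt q) * complex_of_real (sqrt q) = complex_of_real q"
    "complex_of_real (sqrt t) * complex_of_real (sqrt t) = complex_of_real t"
    using q0 t0 by (simp_all flip: of_real_mult)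
  have nz: "complex_of_real (sqrt q) \<noteq> 0" "complex_of_real (sqrt t) \<noteq> 0" using q0 t0 by auto
  have zc: "z * cnj z = complex_of_real ((cmod z)\<^sup>2)" by (simp add: complex_norm_square del: of_real_power)
  have e11: "\<eta> $ 1 * cnj (\<eta> $ 1) = complex_of_real ((cmod z)\<^sup>2 / q / t)"
  proof -
    have "\<eta> $ 1 * cnj (\<eta> $ 1) = z * cnj z / ((complex_of_real (sqrt q) * complex_of_real (sqrt q)) *
        (complex_of_real (sqrt t) * complex_of_real (sqrt t)))"
      by (simp add: \<eta>_def ac_simps)
    then show ?thesis by (simp only: sq zc) simp
  qed
  have e22: "\<eta> $ 2 * cnj (\<eta> $ 2) = complex_of_real (q / t)"
  proof -
    have "\<eta> $ 2 * cnj (\<eta> $ 2) = (complex_of_real (sqrt q) * complex_of_real (sqrt q)) /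
        (complex_of_real (sqrt t) * complex_of_real (sqrt t))"
      by (simp add: \<eta>_def)
    then show ?thesis by (simp only: sq) simp
  qed
  have e12: "\<eta> $ 2 * cnj (\<eta> $ 1) = z / complex_of_real t" "\<eta> $ 1 * cnj (\<eta> $ 2) = cnj z / complex_of_real t"
    using nz by (simp_all add: \<eta>_def divide_simps flip: sq(2))
  have tt: "(cmod z)\<^sup>2 / q / t + q / t = 1"
  proof -
    have "(cmod z)\<^sup>2 / q / t + q / t = ((cmod z)\<^sup>2 / q + q) / t"
      by (simp add: add_divide_distrib)
    also have "(cmod z)\<^sup>2 / q + q = t" by (simp add: t_def)
    finally show ?thesis using t0 by simp
  qed
  show ?thesis
  proof
    show "unit_vector \<eta>"
      unfolding unit_vector_def e11 e22 using tt by (metis of_real_1 of_real_add)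
    show "\<eta> $ 2 \<noteq> 0" using nz by (simp add: \<eta>_def)
    have pt: "p = (cmod z)\<^sup>2 / q + (1 - t)" using pq by (simp add: t_def)
    have "vector_state \<eta> y = (y $ 1 $ 1 * complex_of_real ((cmod z)\<^sup>2 / q) + y $ 1 $ 2 * z
        + y $ 2 $ 1 * cnj z + y $ 2 $ 2 * complex_of_real q) / complex_of_real t" for y
    proof -
      have "vector_state \<eta> y = y $ 1 $ 1 * (\<eta> $ 1 * cnj (\<eta> $ 1)) + y $ 1 $ 2 * (\<eta> $ 2 * cnj (\<eta> $ 1))
        + y $ 2 $ 1 * (\<eta> $ 1 * cnj (\<eta> $ 2)) + y $ 2 $ 2 * (\<eta> $ 2 * cnj (\<eta> $ 2))"
        by (simp add: vector_state_def sum_2 ac_simps)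
      then show ?thesis unfolding e11 e12 e22 by (simp add: add_divide_distrib)
    qed
    then have scaled: "t *\<^sub>R vector_state \<eta> y = y $ 1 $ 1 * complex_of_real ((cmod z)\<^sup>2 / q)
        + y $ 1 $ 2 * z + y $ 2 $ 1 * cnj z + y $ 2 $ 2 * complex_of_real q" for y
      using t0 by (simp add: scaleR_conv_of_real)
    have "\<psi> y = t *\<^sub>R vector_state \<eta> y + (1 - t) *\<^sub>R psi_plus y" for y
      unfolding scaled expand pt
      by (simp add: psi_plus_def scaleR_conv_of_real algebra_simps)
    then show "\<psi> = t *\<^sub>R vector_state \<eta> + (1 - t) *\<^sub>R psi_plus"
      by (simp add: fun_eq_iff scaleR_fun_def)
  qed (use t0 t1 in auto)
qed

text \<open>In the decomposition of a pure state the weight of \<open>psi_plus\<close> must vanish; the two components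
  are different because \<open>psi_plus\<close> does not charge the lower-right entry.\<close>

lemma pure_state_is_vector_state:
  assumes pure: "pure_state \<psi>" and ne: "\<psi> \<noteq> psi_plus"
  obtains \<eta> where "unit_vector \<eta>" "\<eta> $ 2 \<noteq> 0" "\<psi> = vector_state \<eta>"
proof -
  have \<psi>: "\<psi> \<in> states" using pure by (simp add: pure_state_def extreme_point_of_def)
  from state_decomposition[OF this ne] obtain t \<eta> where t: "0 < t" "t \<le> 1" and \<eta>: "unit_vector \<eta>" "\<eta> $ 2 \<noteq> 0"
    and eq: "\<psi> = t *\<^sub>R vector_state \<eta> + (1 - t) *\<^sub>R psi_plus" .
  have "vector_state \<eta> (matrix_unit 2 2) = \<eta> $ 2 * cnj (\<eta> $ 2)" "psi_plus (matrix_unit 2 2) = 0"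
    by (simp_all add: vector_state_def psi_plus_def matrix_unit_def sum_2)
  then have "psi_plus \<noteq> vector_state \<eta>" using \<eta> by force
  moreover have "psi_plus \<in> states" "vector_state \<eta> \<in> states"
    using \<eta> unit_vector_1_0 by (auto simp: psi_plus_vector_state intro: vector_state_in_states)
  moreover have "\<psi> = (1 - t) *\<^sub>R psi_plus + t *\<^sub>R vector_state \<eta>" using eq by (simp add: add.commute)
  ultimately have "t = 1"
    using pure t unfolding pure_state_def extreme_point_of_def in_segment by fastforce
  then show ?thesis using that \<eta> eq by simp
qed

section \<open>The transition operators\<close>

lemma coord_adj_shift: "coord (app (adj shift) \<xi>) n = coord \<xi> (Suc n)"
  by (simp add: coord_adj shift_basis_vec cinner_basis_vec_right)

lemma adj_shift_basis_vec:
  "app (adj shift) (\<e> 0) = 0" "app (adj shift) (\<e> (Suc n)) = \<e> n"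
  by (rule ell2_eqI, simp add: coord_adj_shift coord_basis_vec)+

text \<open>The Kraus operators of the transition operator of a vector state: row \<open>k\<close> of the coupling
  unitary applied to \<open>\<eta>\<close>.\<close>

definition coupling_kraus ::
  "(nat \<Rightarrow> real) \<Rightarrow> (nat \<Rightarrow> real) \<Rightarrow> complex ^ 2 \<Rightarrow> 2 \<Rightarrow> bop" where
  "coupling_kraus \<alpha> \<beta> \<eta> k = (\<Sum>j\<in>UNIV. \<eta> $ j *\<^sub>C coupling \<alpha> \<beta> $ k $ j)"

lemma transition_expand:
  "transition \<alpha> \<beta> \<psi> x = (\<Sum>i\<in>UNIV. \<Sum>j\<in>UNIV. \<psi> (matrix_unit i j) *\<^sub>C
    (\<Sum>k\<in>UNIV. adj (coupling \<alpha> \<beta> $ k $ i) * x * coupling \<alpha> \<beta> $ k $ j))"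
  by (simp add: transition_def slice_def sum_2 matrix_matrix_mult_def adj_matrix_def tensor_def
      mat_def scaleC_one)

lemma vector_state_matrix_unit: "vector_state \<eta> (matrix_unit i j) = \<eta> $ j * cnj (\<eta> $ i)"
  using exhaust_2[of i] exhaust_2[of j]
  by (auto simp: vector_state_def matrix_unit_def sum_2)

lemma transition_vector_state:
  "transition \<alpha> \<beta> (vector_state \<eta>) = kraus_map UNIV (coupling_kraus \<alpha> \<beta> \<eta>)"
  by (simp add: fun_eq_iff transition_expand vector_state_matrix_unit kraus_map_def
      coupling_kraus_def sum_2 adj_add adj_scaleC ring_distribs scaleC_mult_bop scaleC_scaleC
      scaleC_add_right ac_simps)

lemma transition_affine:
  "transition \<alpha> \<beta> (s *\<^sub>R \<phi> + t *\<^sub>R \<psi>) = s *\<^sub>R transition \<alpha> \<beta> \<phi> + t *\<^sub>R transition \<alpha> \<beta> \<psi>"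
  by (simp add: fun_eq_iff transition_expand scaleR_fun_def scaleR_scaleC scaleC_complex_def
      scaleC_sum_right sum.distrib scaleC_add_left scaleC_scaleC sum_2 scaleC_add_right ac_simps)

locale coupled_sequences =
  fixes \<alpha> \<beta> :: "nat \<Rightarrow> real"
  assumes sq_sum: "(\<alpha> n)\<^sup>2 + (\<beta> n)\<^sup>2 = 1"
    and alpha_0: "\<alpha> 0 = 1"
    and beta_nonzero: "n \<ge> 1 \<Longrightarrow> \<beta> n \<noteq> 0"
begin

lemma beta_0: "\<beta> 0 = 0"
  using sq_sum[of 0] alpha_0 by simp

lemma sq_sum_complex:
  "complex_of_real (\<alpha> n) * complex_of_real (\<alpha> n) + complex_of_real (\<beta> n) * complex_of_real (\<beta> n) = 1"
  using arg_cong[OF sq_sum[of n], of complex_of_real] by (simp add: power2_eq_square)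

lemma bounded_ranges:
  "bounded (range (\<lambda>n. complex_of_real (\<alpha> n)))" "bounded (range (\<lambda>n. complex_of_real (\<beta> n)))"
proof -
  have "(\<alpha> n)\<^sup>2 \<le> 1" "(\<beta> n)\<^sup>2 \<le> 1" for n
    using sq_sum[of n] by (smt (verit) zero_le_power2)+
  then have "\<bar>\<alpha> n\<bar> \<le> 1" "\<bar>\<beta> n\<bar> \<le> 1" for n
    by (simp_all add: abs_square_le_1)
  then show "bounded (range (\<lambda>n. complex_of_real (\<alpha> n)))" "bounded (range (\<lambda>n. complex_of_real (\<beta> n)))"
    by (auto simp: bounded_iff intro!: exI[of _ 1])
qed

abbreviation K :: "complex ^ 2 \<Rightarrow> 2 \<Rightarrow> bop" where "K \<equiv> coupling_kraus \<alpha> \<beta>"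

lemma coupling_basis_vec:
  "app (coupling \<alpha> \<beta> $ 1 $ 1) (\<e> n) = complex_of_real (\<alpha> (Suc n)) *\<^sub>C \<e> n"
  "app (coupling \<alpha> \<beta> $ 1 $ 2) (\<e> 0) = 0"
  "app (coupling \<alpha> \<beta> $ 1 $ 2) (\<e> (Suc n)) = (\<i> * complex_of_real (\<beta> (Suc n))) *\<^sub>C \<e> n"
  "app (coupling \<alpha> \<beta> $ 2 $ 1) (\<e> n) = (\<i> * complex_of_real (\<beta> (Suc n))) *\<^sub>C \<e> (Suc n)"
  "app (coupling \<alpha> \<beta> $ 2 $ 2) (\<e> n) = complex_of_real (\<alpha> n) *\<^sub>C \<e> n"
  by (simp_all add: coupling_def Let_def shift_basis_vec diag_basis_vec bounded_ranges
      adj_shift_basis_vec app_linear scaleC_scaleC beta_0)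

lemma K_basis_vec:
  "app (K \<eta> 1) (\<e> 0) = (\<eta> $ 1 * complex_of_real (\<alpha> 1)) *\<^sub>C \<e> 0"
  "app (K \<eta> 1) (\<e> (Suc n)) = (\<eta> $ 1 * complex_of_real (\<alpha> (Suc (Suc n)))) *\<^sub>C \<e> (Suc n)
    + (\<eta> $ 2 * \<i> * complex_of_real (\<beta> (Suc n))) *\<^sub>C \<e> n"
  "app (K \<eta> 2) (\<e> n) = (\<eta> $ 1 * \<i> * complex_of_real (\<beta> (Suc n))) *\<^sub>C \<e> (Suc n)
    + (\<eta> $ 2 * complex_of_real (\<alpha> n)) *\<^sub>C \<e> n"
  by (simp_all add: coupling_kraus_def sum_2 coupling_basis_vec scaleC_scaleC mult.assoc)

lemmas gram_simps = cinner_add_left cinner_add_right cinner_scaleC_left cinner_scaleC_right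
  cinner_basis_vec_right coord_basis_vec K_basis_vec

text \<open>The matrix in question is the sum over \<open>k\<close> of the Gram matrices of the vectors \<open>v\<^sub>k e\<^sub>n\<close>. On the
  diagonal, \<open>\<alpha>\<^sub>n\<^sup>2 + \<beta>\<^sub>n\<^sup>2 = 1\<close> reduces the entries to the squared norm of \<open>\<eta>\<close>; next to
  the diagonal the contributions of \<open>v\<^sub>1\<close> and \<open>v\<^sub>2\<close> cancel. This is the isometry property of the coupling.\<close>

lemma K_unital:
  assumes "unit_vector \<eta>"
  shows "(\<Sum>k\<in>UNIV. adj (K \<eta> k) * K \<eta> k) = 1"
proof (rule bop_eqI_basis)
  fix n m
  define x where "x = \<eta> $ 1"
  define y where "y = \<eta> $ 2"
  have x: "x * cnj x = 1 - y * cnj y"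
    using assms by (simp add: unit_vector_def x_def y_def algebra_simps)
  have b: "complex_of_real (\<beta> n) * complex_of_real (\<beta> n) = 1 - complex_of_real (\<alpha> n) * complex_of_real (\<alpha> n)" for n
    using sq_sum_complex[of n] by (simp add: algebra_simps)
  have "cinner (app (K \<eta> 1) (\<e> n)) (app (K \<eta> 1) (\<e> m)) + cinner (app (K \<eta> 2) (\<e> n)) (app (K \<eta> 2) (\<e> m))
      = (if n = m then 1 else 0)"
  proof (cases "n = m")
    case True
    have *: "x * a1 * (cnj x * a1) + (y * a * (cnj y * a) + (x * b1 * (cnj x * b1) + y * b0 * (cnj y * b0))) = 1"
      if "b1 * b1 = 1 - a1 * a1" "b0 * b0 = 1 - a * a" for a a1 b0 b1
    proof -
      have "x * a1 * (cnj x * a1) + (y * a * (cnj y * a) + (x * b1 * (cnj x * b1) + y * b0 * (cnj y * b0)))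
        = (x * cnj x) * (a1 * a1 + b1 * b1) + (y * cnj y) * (a * a + b0 * b0)"
        by (simp add: algebra_simps)
      then show ?thesis using that x by simp
    qed
    show ?thesis
    proof (cases n)
      case 0
      then show ?thesis using True *[OF b b, of 1 0]
        by (simp add: gram_simps alpha_0 beta_0 flip: x_def y_def) (simp add: algebra_simps)
    next
      case (Suc k)
      then show ?thesis using True *[OF b b, of "Suc n" n]
        by (simp add: gram_simps flip: x_def y_def) (simp add: algebra_simps)
    qed
  next
    case False
    then show ?thesis
      by (cases n; cases m) (auto simp: gram_simps)
  qed
  then show "coord (app (\<Sum>k\<in>UNIV. adj (K \<eta> k) * K \<eta> k) (\<e> n)) m = coord (app 1 (\<e> n)) m"
    by (auto simp: sum_2 coord_adj coord_basis_vec)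
qed

text \<open>By the decomposition of states, a transition operator is a convex combination of two Kraus maps.\<close>

lemma transition_in_UCP:
  assumes "\<psi> \<in> states"
  shows "transition \<alpha> \<beta> \<psi> \<in> UCP"
proof (cases "\<psi> = psi_plus")
  case True
  then show ?thesis
    using kraus_map_UCP[OF _ K_unital[OF unit_vector_1_0]]
    by (simp add: psi_plus_vector_state transition_vector_state)
next
  case False
  from state_decomposition[OF assms this] obtain t \<eta> where t: "0 < t" "t \<le> 1" and \<eta>: "unit_vector \<eta>"
    and \<psi>: "\<psi> = t *\<^sub>R vector_state \<eta> + (1 - t) *\<^sub>R psi_plus" by blast
  show ?thesis
    unfolding \<psi> psi_plus_vector_state transition_affine transition_vector_state
    using t by (intro kraus_map_convex_UCP K_unital \<eta> unit_vector_1_0) auto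
qed

text \<open>Three entries of the transition operator that separate states.\<close>

lemma transition_matrix_units:
  "coord (app (transition \<alpha> \<beta> \<psi> (rank_one (\<e> 0) (\<e> 0))) (\<e> 0)) 0
    = \<psi> (matrix_unit 1 1) * complex_of_real ((\<alpha> 1)\<^sup>2) + \<psi> (matrix_unit 2 2)"
  "coord (app (transition \<alpha> \<beta> \<psi> (rank_one (\<e> 1) (\<e> 0))) (\<e> 0)) 0
    = - \<i> * complex_of_real (\<beta> 1) * \<psi> (matrix_unit 1 2)"
  "coord (app (transition \<alpha> \<beta> \<psi> (rank_one (\<e> 0) (\<e> 1))) (\<e> 0)) 0
    = \<i> * complex_of_real (\<beta> 1) * \<psi> (matrix_unit 2 1)"
  by (simp_all add: transition_expand sum_2 coord_adj coupling_basis_vec gram_simps alpha_0 power2_eq_square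
     algebra_simps)

text \<open>The first entry is \<open>1 - (\<beta> 1)\<^sup>2 * \<psi> (matrix_unit 1 1)\<close> by normalisation, and the other two are
  nonzero multiples of the off-diagonal values; as \<open>\<beta> 1 \<noteq> 0\<close>, they determine the state.\<close>

lemma transition_inj:
  assumes "\<phi> \<in> states" "\<psi> \<in> states" and eq: "transition \<alpha> \<beta> \<phi> = transition \<alpha> \<beta> \<psi>"
  shows "\<phi> = \<psi>"
proof -
  note entries = transition_matrix_units[of \<phi>, unfolded eq, unfolded transition_matrix_units]
  have b: "complex_of_real (\<beta> 1) \<noteq> 0" using beta_nonzero[of 1] by simp
  have "(\<psi> (matrix_unit 1 1) - \<phi> (matrix_unit 1 1)) * (1 - complex_of_real ((\<alpha> 1)\<^sup>2)) = 0"
    using entries(1) state_trace[OF assms(1)] state_trace[OF assms(2)] by (simp add: algebra_simps)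
  moreover have "1 - complex_of_real ((\<alpha> 1)\<^sup>2) = complex_of_real (\<beta> 1) * complex_of_real (\<beta> 1)"
    using sq_sum_complex[of 1] by (simp add: power2_eq_square algebra_simps)
  then have "1 - complex_of_real ((\<alpha> 1)\<^sup>2) \<noteq> 0" using b by simp
  ultimately have 11: "\<phi> (matrix_unit 1 1) = \<psi> (matrix_unit 1 1)" by simp
  then have 22: "\<phi> (matrix_unit 2 2) = \<psi> (matrix_unit 2 2)"
    using state_trace[OF assms(1)] state_trace[OF assms(2)] by simp
  have "\<phi> (matrix_unit 1 2) = \<psi> (matrix_unit 1 2)" "\<phi> (matrix_unit 2 1) = \<psi> (matrix_unit 2 1)"
    using entries(2,3) b by simp_all
  moreover have "clinear \<phi>" "clinear \<psi>" using assms by (simp_all add: states_def)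
  ultimately have "\<phi> y = \<psi> y" for y
    using 11 22 clinear_matrix_expand[of \<phi> y] clinear_matrix_expand[of \<psi> y] by simp
  then show ?thesis by blast
qed

lemma not_pure_imp_not_extreme:
  assumes \<psi>: "\<psi> \<in> states" and np: "\<not> pure_state \<psi>"
  shows "\<not> transition \<alpha> \<beta> \<psi> extreme_point_of UCP"
proof -
  obtain \<phi> \<sigma> where st: "\<phi> \<in> states" "\<sigma> \<in> states" and seg: "\<psi> \<in> open_segment \<phi> \<sigma>"
    using \<psi> np by (auto simp: pure_state_def extreme_point_of_def)
  then obtain u where ne: "\<phi> \<noteq> \<sigma>" and u: "0 < u" "u < 1" "\<psi> = (1 - u) *\<^sub>R \<phi> + u *\<^sub>R \<sigma>"
    by (auto simp: in_segment)
  have "transition \<alpha> \<beta> \<psi> \<in> open_segment (transition \<alpha> \<beta> \<phi>) (transition \<alpha> \<beta> \<sigma>)"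
    unfolding in_segment using ne transition_inj[OF st] u by (auto simp: transition_affine)
  then show ?thesis
    using transition_in_UCP st by (auto simp: extreme_point_of_def)
qed

end

section \<open>Pure states other than \<open>psi_plus\<close>\<close>

context coupled_sequences
begin

lemma kraus_relation_coefficients:
  fixes c :: "2 \<Rightarrow> 2 \<Rightarrow> complex"
  assumes "(\<Sum>j\<in>S. \<Sum>k\<in>S. c j k *\<^sub>C (adj (v j) * v k)) = 0"
  shows "(\<Sum>j\<in>S. \<Sum>k\<in>S. c j k * cinner (app (v k) (\<e> n)) (app (v j) (\<e> m))) = 0"
  using arg_cong[OF assms, of "\<lambda>x. coord (app x (\<e> n)) m"]
  by (simp add: app_sum_left coord_adj)

text \<open>The product \<open>v\<^sub>1\<^sup>* v\<^sub>2\<close> reaches two steps below the diagonal if \<open>\<eta>\<^sub>1 \<noteq> 0\<close>, farther than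
  \<open>v\<^sub>k\<^sup>* v\<^sub>k\<close>; if \<open>\<eta>\<^sub>1 = 0\<close> those two are diagonal and it has a nonzero entry one step below. So the
  mixed products have coefficient zero. As \<open>v\<^sub>1\<^sup>* v\<^sub>1 + v\<^sub>2\<^sup>* v\<^sub>2 = 1\<close>, it remains to see that
  \<open>v\<^sub>1\<^sup>* v\<^sub>1\<close> is not scalar: if it is diagonal, then \<open>\<eta>\<^sub>1 \<alpha>\<^sub>n\<^sub>+\<^sub>1 = 0\<close> for all \<open>n\<close>, and its first two
  diagonal entries are \<open>0\<close> and \<open>\<bar>\<eta>\<^sub>2\<bar>\<^sup>2 \<beta>\<^sub>1\<^sup>2\<close>.\<close>

lemma K_independent:
  assumes \<eta>: "unit_vector \<eta>" and \<eta>2: "\<eta> $ 2 \<noteq> 0"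
    and rel: "(\<Sum>j\<in>UNIV. \<Sum>k\<in>UNIV. c j k *\<^sub>C (adj (K \<eta> j) * K \<eta> k)) = 0"
  shows "\<forall>j\<in>UNIV. \<forall>k\<in>UNIV. c j k = 0"
proof -
  define x where "x = \<eta> $ 1"
  define y where "y = \<eta> $ 2"
  have y: "y \<noteq> 0" using \<eta>2 by (simp add: y_def)
  have unit: "x * cnj x + y * cnj y = 1" using \<eta> by (simp add: unit_vector_def x_def y_def)
  note E = kraus_relation_coefficients[OF rel, unfolded sum_2]
  have b: "complex_of_real (\<beta> (Suc n)) \<noteq> 0" for n using beta_nonzero[of "Suc n"] by simp
  have c12: "c 1 2 = 0" and c21: "c 2 1 = 0"
  proof -
    consider "x = 0" | "x \<noteq> 0" by blast
    then show "c 1 2 = 0"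
    proof cases
      case 1
      then show ?thesis using E[of 0 "Suc 0"] y b[of 0]
        by (simp add: gram_simps alpha_0 flip: x_def y_def)
    next
      case 2
      then show ?thesis using E[of 0 "Suc (Suc 0)"] y b[of 0] b[of 1]
        by (simp add: gram_simps flip: x_def y_def)
    qed
    consider "x = 0" | "x \<noteq> 0" by blast
    then show "c 2 1 = 0"
    proof cases
      case 1
      then show ?thesis using E[of "Suc 0" 0] y b[of 0]
        by (simp add: gram_simps alpha_0 flip: x_def y_def)
    next
      case 2
      then show ?thesis using E[of "Suc (Suc 0)" 0] y b[of 0] b[of 1]
        by (simp add: gram_simps flip: x_def y_def)
    qed
  qed
  have G: "cinner (app (K \<eta> 2) (\<e> n)) (app (K \<eta> 2) (\<e> m))
      = (if n = m then 1 else 0) - cinner (app (K \<eta> 1) (\<e> n)) (app (K \<eta> 1) (\<e> m))" for n m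
    using arg_cong[OF K_unital[OF \<eta>], of "\<lambda>x. coord (app x (\<e> n)) m"]
    by (simp add: sum_2 coord_adj coord_basis_vec algebra_simps)
  have diff: "(c 1 1 - c 2 2) * cinner (app (K \<eta> 1) (\<e> n)) (app (K \<eta> 1) (\<e> m))
      + (if n = m then c 2 2 else 0) = 0" for n m
    using E[of n m] by (simp add: c12 c21 G algebra_simps split: if_splits)
  have eq: "c 1 1 = c 2 2"
  proof (rule ccontr)
    assume ne: "c 1 1 \<noteq> c 2 2"
    have xa: "x = 0 \<or> \<alpha> (Suc n) = 0" for n
    proof -
      have "cinner (app (K \<eta> 1) (\<e> n)) (app (K \<eta> 1) (\<e> (Suc n)))
          = x * complex_of_real (\<alpha> (Suc n)) * cnj (y * \<i> * complex_of_real (\<beta> (Suc n)))"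
        by (cases n) (simp_all add: gram_simps flip: x_def y_def)
      then show ?thesis using diff[of n "Suc n"] ne y b[of n] by auto
    qed
    have "cinner (app (K \<eta> 1) (\<e> 0)) (app (K \<eta> 1) (\<e> 0)) = 0"
      using xa[of 0] by (auto simp: gram_simps simp flip: x_def y_def)
    then have 22: "c 2 2 = 0" using diff[of 0 0] by simp
    have "cinner (app (K \<eta> 1) (\<e> (Suc 0))) (app (K \<eta> 1) (\<e> (Suc 0)))
        = (y * \<i> * complex_of_real (\<beta> (Suc 0))) * cnj (y * \<i> * complex_of_real (\<beta> (Suc 0)))"
      using xa[of 1] by (auto simp: gram_simps simp flip: x_def y_def)
    then show False using diff[of "Suc 0" "Suc 0"] ne y b[of 0] 22 by simp
  qed
  then have "c 2 2 = 0" using diff[of 0 0] by simp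
  then show ?thesis using eq c12 c21 by (simp add: forall_2)
qed

lemma pure_imp_extreme:
  assumes "pure_state \<psi>" "\<psi> \<noteq> psi_plus"
  shows "transition \<alpha> \<beta> \<psi> extreme_point_of UCP"
proof -
  obtain \<eta> where \<eta>: "unit_vector \<eta>" "\<eta> $ 2 \<noteq> 0" "\<psi> = vector_state \<eta>"
    using pure_state_is_vector_state[OF assms] .
  show ?thesis
    unfolding \<eta>(3) transition_vector_state
    by (rule kraus_map_extreme_point[OF _ K_unital[OF \<eta>(1)] K_independent[OF \<eta>(1,2)]]) simp_all
qed

section \<open>The state \<open>psi_plus\<close>\<close>

abbreviation K_plus :: "2 \<Rightarrow> bop" where "K_plus \<equiv> K (vector [1, 0])"

lemma K_plus_basis_vec:
  "app (K_plus 1) (\<e> n) = complex_of_real (\<alpha> (Suc n)) *\<^sub>C \<e> n"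
  "app (K_plus 2) (\<e> n) = (\<i> * complex_of_real (\<beta> (Suc n))) *\<^sub>C \<e> (Suc n)"
  by (cases n; simp add: K_basis_vec)+

lemma transition_psi_plus: "transition \<alpha> \<beta> psi_plus = kraus_map UNIV K_plus"
  by (simp add: psi_plus_vector_state transition_vector_state)

lemmas gram_plus_simps = cinner_add_left cinner_add_right cinner_diff_right cinner_scaleC_left
  cinner_scaleC_right cinner_basis_vec_right coord_basis_vec K_plus_basis_vec

text \<open>The single remaining Kraus operator is an isometry.\<close>

lemma K_plus_zero_case:
  assumes "\<And>n. \<alpha> (Suc n) = 0"
  shows "transition \<alpha> \<beta> psi_plus extreme_point_of UCP"
proof -
  have "K_plus 1 = 0" by (rule bop_eqI_basis) (simp add: K_plus_basis_vec assms)
  then have eq: "kraus_map UNIV K_plus = kraus_map {2} K_plus"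
    by (simp add: kraus_map_def sum_2 fun_eq_iff)
  have unital: "(\<Sum>k\<in>{2}. adj (K_plus k) * K_plus k) = 1"
    using K_unital[OF unit_vector_1_0] \<open>K_plus 1 = 0\<close> by (simp add: sum_2)
  have "c 2 2 = 0" if "(\<Sum>j\<in>{2}. \<Sum>k\<in>{2}. c j k *\<^sub>C (adj (K_plus j) * K_plus k)) = 0" for c :: "2 \<Rightarrow> 2 \<Rightarrow> complex"
    using kraus_relation_coefficients[OF that, of 0 0] beta_nonzero[of 1] by (simp add: gram_plus_simps)
  then show ?thesis
    unfolding transition_psi_plus eq by (intro kraus_map_extreme_point unital) auto
qed

text \<open>The mixed products live on the first off-diagonals, where the weight \<open>\<beta>\<^sub>p\<^sub>+\<^sub>1 \<alpha>\<^sub>p\<^sub>+\<^sub>2\<close> is nonzero. The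
  two diagonal products sum to \<open>1\<close>, and the first takes two different values.\<close>

lemma K_plus_independent:
  assumes p: "\<alpha> (Suc (Suc p)) \<noteq> 0" and q: "(\<alpha> (Suc q))\<^sup>2 \<noteq> (\<alpha> (Suc r))\<^sup>2"
    and rel: "(\<Sum>j\<in>UNIV. \<Sum>k\<in>UNIV. c j k *\<^sub>C (adj (K_plus j) * K_plus k)) = 0"
  shows "\<forall>j\<in>UNIV. \<forall>k\<in>UNIV. c j k = 0"
proof -
  note E = kraus_relation_coefficients[OF rel, unfolded sum_2]
  have b: "complex_of_real (\<beta> (Suc n)) \<noteq> 0" for n using beta_nonzero[of "Suc n"] by simp
  have "c 1 2 = 0" using E[of p "Suc p"] p b[of p] by (simp add: gram_plus_simps)
  have "c 2 1 = 0" using E[of "Suc p" p] p b[of p] by (simp add: gram_plus_simps)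
  have d: "c 1 1 * complex_of_real ((\<alpha> (Suc n))\<^sup>2) + c 2 2 * (1 - complex_of_real ((\<alpha> (Suc n))\<^sup>2)) = 0" for n
  proof -
    have "1 - complex_of_real ((\<alpha> (Suc n))\<^sup>2) = complex_of_real (\<beta> (Suc n)) * complex_of_real (\<beta> (Suc n))"
      using sq_sum_complex[of "Suc n"] by (simp add: power2_eq_square algebra_simps)
    moreover have "\<i> * z * (\<i> * z) = - (z * z)" for z
      by (simp add: power2_eq_square[symmetric] power_mult_distrib)
    ultimately show ?thesis using E[of n n] by (simp add: gram_plus_simps power2_eq_square)
  qed
  have d': "(c 1 1 - c 2 2) * complex_of_real ((\<alpha> (Suc n))\<^sup>2) = - c 2 2" for n
    unfolding eq_neg_iff_add_eq_0 using d[of n] by (simp add: algebra_simps)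
  then have "(c 1 1 - c 2 2) * (complex_of_real ((\<alpha> (Suc q))\<^sup>2) - complex_of_real ((\<alpha> (Suc r))\<^sup>2)) = 0"
    unfolding right_diff_distrib d' by simp
  moreover have "complex_of_real ((\<alpha> (Suc q))\<^sup>2) \<noteq> complex_of_real ((\<alpha> (Suc r))\<^sup>2)"
    using q of_real_eq_iff by blast
  ultimately have "c 1 1 = c 2 2" by simp
  moreover from this have "c 2 2 = 0" using d'[of q] by simp
  ultimately show ?thesis using \<open>c 1 2 = 0\<close> \<open>c 2 1 = 0\<close> by (simp add: forall_2)
qed

text \<open>Dividing the Kraus operators by \<open>sqrt t\<close> and \<open>sqrt (1 - t)\<close> turns them into isometries, and the
  map is the convex combination of the two conjugations with weights \<open>t\<close> and \<open>1 - t\<close>.\<close>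

lemma K_plus_constant_case:
  assumes const: "\<And>n. (\<alpha> (Suc n))\<^sup>2 = t" and t: "t \<noteq> 0"
  shows "\<not> transition \<alpha> \<beta> psi_plus extreme_point_of UCP"
proof -
  have t01: "0 < t" "t < 1"
  proof -
    have "t \<ge> 0" using const[of 0] zero_le_power2[of "\<alpha> (Suc 0)"] by simp
    then show "0 < t" using t by simp
    have "(\<beta> (Suc 0))\<^sup>2 > 0" using beta_nonzero[of "Suc 0"] by simp
    then show "t < 1" using sq_sum[of "Suc 0"] const[of 0] by linarith
  qed
  have beta: "(\<beta> (Suc n))\<^sup>2 = 1 - t" for n using sq_sum[of "Suc n"] const[of n] by simp
  have sq: "complex_of_real (\<alpha> (Suc n)) * complex_of_real (\<alpha> (Suc n)) = complex_of_real t"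
    "complex_of_real (\<beta> (Suc n)) * complex_of_real (\<beta> (Suc n)) = complex_of_real (1 - t)" for n
    using const[of n] beta[of n] by (simp_all only: power2_eq_square flip: of_real_mult)
  have isq: "\<i> * complex_of_real (\<beta> (Suc n)) * (\<i> * complex_of_real (\<beta> (Suc n)))
      = - complex_of_real (1 - t)" for n
    unfolding sq(2)[of n, symmetric] by (simp add: power2_eq_square[symmetric] power_mult_distrib)
  have nz: "complex_of_real (1 - t) \<noteq> 0" using t01 by (simp del: of_real_diff)
  define A where "A = (1 / t) *\<^sub>R kraus_map {1} K_plus"
  define B where "B = (1 / (1 - t)) *\<^sub>R kraus_map {2} K_plus"
  have A_kraus: "A = kraus_map {1} (\<lambda>k. complex_of_real (sqrt (1 / t)) *\<^sub>C K_plus k)"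
    unfolding kraus_map_scale A_def using t01 by simp
  have B_kraus: "B = kraus_map {2} (\<lambda>k. complex_of_real (sqrt (1 / (1 - t))) *\<^sub>C K_plus k)"
    unfolding kraus_map_scale B_def using t01 by simp
  have "A 1 = 1"
    using t01 by (intro bop_eqI_basis)
      (auto simp: A_def kraus_map_def scaleR_fun_def scaleR_scaleC coord_adj gram_plus_simps sq)
  then have A: "A \<in> UCP"
    unfolding A_kraus by (intro kraus_map_UCP) (auto simp: kraus_map_def)
  have "B 1 = 1"
    using nz by (intro bop_eqI_basis)
      (auto simp: B_def kraus_map_def scaleR_fun_def scaleR_scaleC coord_adj gram_plus_simps isq
        simp del: of_real_diff)
  then have B: "B \<in> UCP"
    unfolding B_kraus by (intro kraus_map_UCP) (auto simp: kraus_map_def)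
  have "coord (app (A (rank_one (\<e> 0) (\<e> 0))) (\<e> 0)) 0 = 1" "coord (app (B (rank_one (\<e> 0) (\<e> 0))) (\<e> 0)) 0 = 0"
    using t01 by (simp_all add: A_def B_def kraus_map_def scaleR_fun_def scaleR_scaleC coord_adj gram_plus_simps sq)
  then have "B \<noteq> A" by auto
  moreover have "transition \<alpha> \<beta> psi_plus = (1 - t) *\<^sub>R B + t *\<^sub>R A"
    using t01 by (simp add: transition_psi_plus A_def B_def kraus_map_def fun_eq_iff scaleR_fun_def sum_2)
  ultimately have "transition \<alpha> \<beta> psi_plus \<in> open_segment B A"
    using t01 by (auto simp: in_segment)
  then show ?thesis using A B by (auto simp: extreme_point_of_def)
qed

text \<open>Here \<open>v\<^sub>1\<^sup>* v\<^sub>2 = 0\<close>, so \<open>v\<^sub>1 + v\<^sub>2\<close> and \<open>v\<^sub>1 - v\<^sub>2\<close> are isometries; the cross terms of the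
  two conjugations cancel in their average. They do not vanish themselves, because \<open>\<alpha>\<^sub>1\<close> and \<open>\<beta>\<^sub>1\<close>
  are nonzero.\<close>

lemma K_plus_rank_one_case:
  assumes one: "\<alpha> 1 \<noteq> 0" and zero: "\<And>n. \<alpha> (Suc (Suc n)) = 0"
  shows "\<not> transition \<alpha> \<beta> psi_plus extreme_point_of UCP"
proof -
  have orth: "adj (K_plus 1) * K_plus 2 = 0" "adj (K_plus 2) * K_plus 1 = 0"
    by (rule bop_eqI_basis, auto simp: coord_adj gram_plus_simps zero)+
  define A where "A = kraus_map {1::2} (\<lambda>_. K_plus 1 + K_plus 2)"
  define B where "B = kraus_map {1::2} (\<lambda>_. K_plus 1 - K_plus 2)"
  have u: "adj (K_plus 1) * K_plus 1 + adj (K_plus 2) * K_plus 2 = 1"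
    using K_unital[OF unit_vector_1_0] by (simp add: sum_2)
  have A: "A \<in> UCP" unfolding A_def
    using u by (intro kraus_map_UCP) (simp_all add: adj_add ring_distribs orth)
  have B: "B \<in> UCP" unfolding B_def
    using u by (intro kraus_map_UCP)
      (simp_all add: adj_diff algebra_simps orth)
  have "coord (app (A (rank_one (\<e> 1) (\<e> 0))) (\<e> 0)) 0 = - coord (app (B (rank_one (\<e> 1) (\<e> 0))) (\<e> 0)) 0"
    "coord (app (A (rank_one (\<e> 1) (\<e> 0))) (\<e> 0)) 0 \<noteq> 0"
    using one beta_nonzero[of 1]
    by (simp_all add: A_def B_def kraus_map_def coord_adj gram_plus_simps)
  then have "A \<noteq> B" by force
  moreover have "transition \<alpha> \<beta> psi_plus = (1 - 1 / 2) *\<^sub>R A + (1 / 2) *\<^sub>R B"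
  proof
    fix x
    have "A x + B x = 2 *\<^sub>R transition \<alpha> \<beta> psi_plus x"
      by (simp add: A_def B_def transition_psi_plus kraus_map_def sum_2 adj_add adj_diff
          algebra_simps scaleR_2)
    then have "(1 / 2) *\<^sub>R (A x + B x) = transition \<alpha> \<beta> psi_plus x" by simp
    then show "transition \<alpha> \<beta> psi_plus x = ((1 - 1 / 2) *\<^sub>R A + (1 / 2) *\<^sub>R B) x"
      by (simp add: scaleR_fun_def scaleR_add_right)
  qed
  ultimately have "transition \<alpha> \<beta> psi_plus \<in> open_segment A B"
    unfolding in_segment by (intro conjI exI[of _ "1 / 2"]) auto
  then show ?thesis using A B by (auto simp: extreme_point_of_def)
qed

lemma compressed_square_basis_vec:
  "app (adj shift * (diag (\<lambda>n. complex_of_real (\<alpha> n)))\<^sup>2 * shift) (\<e> n)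
    = complex_of_real ((\<alpha> (Suc n))\<^sup>2) *\<^sub>C \<e> n"
  by (simp add: power2_eq_square shift_basis_vec diag_basis_vec bounded_ranges app_linear
      adj_shift_basis_vec scaleC_scaleC)

lemma compressed_square_scalar_iff:
  "adj shift * (diag (\<lambda>n. complex_of_real (\<alpha> n)))\<^sup>2 * shift = c *\<^sub>C 1
    \<longleftrightarrow> (\<forall>n. complex_of_real ((\<alpha> (Suc n))\<^sup>2) = c)" (is "?x = _ \<longleftrightarrow> _")
proof
  assume eq: "?x = c *\<^sub>C 1"
  show "\<forall>n. complex_of_real ((\<alpha> (Suc n))\<^sup>2) = c"
  proof
    fix n
    have "coord (app ?x (\<e> n)) n = coord (app (c *\<^sub>C 1) (\<e> n)) n" using eq by simp
    then show "complex_of_real ((\<alpha> (Suc n))\<^sup>2) = c"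
      unfolding compressed_square_basis_vec by (simp add: coord_basis_vec)
  qed
next
  assume "\<forall>n. complex_of_real ((\<alpha> (Suc n))\<^sup>2) = c"
  then show "?x = c *\<^sub>C 1"
    by (intro bop_eqI_basis) (simp only: compressed_square_basis_vec, simp)
qed

lemma compressed_square_proj0_iff:
  "adj shift * (diag (\<lambda>n. complex_of_real (\<alpha> n)))\<^sup>2 * shift = c *\<^sub>C proj0
    \<longleftrightarrow> complex_of_real ((\<alpha> 1)\<^sup>2) = c \<and> (\<forall>n. \<alpha> (Suc (Suc n)) = 0)" (is "?x = _ \<longleftrightarrow> _")
proof
  assume eq: "?x = c *\<^sub>C proj0"
  have *: "complex_of_real ((\<alpha> (Suc n))\<^sup>2) = (if n = 0 then c else 0)" for n
  proof -
    have "coord (app ?x (\<e> n)) n = coord (app (c *\<^sub>C proj0) (\<e> n)) n" using eq by simp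
    then show ?thesis
      unfolding compressed_square_basis_vec
      by (simp add: coord_basis_vec proj0.rep_eq cinner_basis_vec_right split: if_splits)
  qed
  show "complex_of_real ((\<alpha> 1)\<^sup>2) = c \<and> (\<forall>n. \<alpha> (Suc (Suc n)) = 0)"
    using *[of 0] *[of "Suc _"] by simp
next
  assume "complex_of_real ((\<alpha> 1)\<^sup>2) = c \<and> (\<forall>n. \<alpha> (Suc (Suc n)) = 0)"
  then have "complex_of_real ((\<alpha> (Suc n))\<^sup>2) = (if n = 0 then c else 0)" for n
    by (cases n) auto
  then show "?x = c *\<^sub>C proj0"
    by (intro bop_eqI_basis)
      (simp only: compressed_square_basis_vec,
        auto simp: proj0.rep_eq cinner_basis_vec_right coord_basis_vec)
qed

text \<open>If some \<open>\<alpha>\<^sub>p\<^sub>+\<^sub>2\<close> is nonzero, non-extremality forces \<open>\<alpha>\<^sub>n\<^sub>+\<^sub>1\<^sup>2\<close> to be constant. Otherwise only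
  \<open>\<alpha>\<^sub>1\<close> can be nonzero, and it is, since the map with vanishing \<open>v\<^sub>1\<close> is extreme.\<close>

lemma psi_plus_extreme_iff:
  "\<not> transition \<alpha> \<beta> psi_plus extreme_point_of UCP \<longleftrightarrow>
    (\<exists>c::complex. c \<noteq> 0 \<and>
      (adj shift * (diag (\<lambda>n. complex_of_real (\<alpha> n)))\<^sup>2 * shift = c *\<^sub>C 1 \<or>
       adj shift * (diag (\<lambda>n. complex_of_real (\<alpha> n)))\<^sup>2 * shift = c *\<^sub>C proj0))"
  unfolding compressed_square_scalar_iff compressed_square_proj0_iff
proof
  assume ne: "\<not> transition \<alpha> \<beta> psi_plus extreme_point_of UCP"
  show "\<exists>c. c \<noteq> 0 \<and> ((\<forall>n. complex_of_real ((\<alpha> (Suc n))\<^sup>2) = c) \<or>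
    (complex_of_real ((\<alpha> 1)\<^sup>2) = c \<and> (\<forall>n. \<alpha> (Suc (Suc n)) = 0)))"
  proof (cases "\<exists>p. \<alpha> (Suc (Suc p)) \<noteq> 0")
    case True
    then obtain p where p: "\<alpha> (Suc (Suc p)) \<noteq> 0" by blast
    have "(\<alpha> (Suc n))\<^sup>2 = (\<alpha> (Suc (Suc p)))\<^sup>2" for n
    proof (rule ccontr)
      assume q: "(\<alpha> (Suc n))\<^sup>2 \<noteq> (\<alpha> (Suc (Suc p)))\<^sup>2"
      have "kraus_map UNIV K_plus extreme_point_of UCP"
        by (rule kraus_map_extreme_point[OF _ K_unital[OF unit_vector_1_0] K_plus_independent[OF p q]]) simp_all
      then show False using ne by (simp add: transition_psi_plus)
    qed
    then have "\<forall>n. complex_of_real ((\<alpha> (Suc n))\<^sup>2) = complex_of_real ((\<alpha> (Suc (Suc p)))\<^sup>2)"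
      by metis
    moreover have "complex_of_real ((\<alpha> (Suc (Suc p)))\<^sup>2) \<noteq> 0" using p by simp
    ultimately show ?thesis by blast
  next
    case False
    then have zero: "\<alpha> (Suc (Suc n)) = 0" for n by blast
    have "\<alpha> 1 \<noteq> 0"
    proof
      assume "\<alpha> 1 = 0"
      then have "\<alpha> (Suc n) = 0" for n using zero by (cases n) auto
      then show False using K_plus_zero_case ne by blast
    qed
    then show ?thesis using zero by (intro exI[of _ "complex_of_real ((\<alpha> 1)\<^sup>2)"]) simp
  qed
next
  assume "\<exists>c. c \<noteq> 0 \<and> ((\<forall>n. complex_of_real ((\<alpha> (Suc n))\<^sup>2) = c) \<or>
    (complex_of_real ((\<alpha> 1)\<^sup>2) = c \<and> (\<forall>n. \<alpha> (Suc (Suc n)) = 0)))"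
  then obtain c where c: "c \<noteq> 0" and
    cases: "(\<forall>n. complex_of_real ((\<alpha> (Suc n))\<^sup>2) = c) \<or>
      (complex_of_real ((\<alpha> 1)\<^sup>2) = c \<and> (\<forall>n. \<alpha> (Suc (Suc n)) = 0))"
    by blast
  from cases show "\<not> transition \<alpha> \<beta> psi_plus extreme_point_of UCP"
  proof
    assume const: "\<forall>n. complex_of_real ((\<alpha> (Suc n))\<^sup>2) = c"
    show ?thesis
    proof (rule K_plus_constant_case)
      show "(\<alpha> (Suc n))\<^sup>2 = (\<alpha> (Suc 0))\<^sup>2" for n
        using const by (metis of_real_eq_iff)
      show "(\<alpha> (Suc 0))\<^sup>2 \<noteq> 0" using const[rule_format, of 0] c by auto
    qed
  next
    assume "complex_of_real ((\<alpha> 1)\<^sup>2) = c \<and> (\<forall>n. \<alpha> (Suc (Suc n)) = 0)"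
    then show ?thesis using c by (intro K_plus_rank_one_case) auto
  qed
qed

end

section \<open>Extreme transition operators\<close>

theorem theorem3p9:
  fixes \<alpha> \<beta> :: "nat \<Rightarrow> real"
  assumes "\<And>n. \<alpha> n \<in> {-1..1}"
    and "\<And>n. \<beta> n \<in> {-1..1}"
    and "\<And>n. (\<alpha> n)\<^sup>2 + (\<beta> n)\<^sup>2 = 1"
    and "\<alpha> 0 = 1"
    and "\<And>n. n \<ge> 1 \<Longrightarrow> \<beta> n \<noteq> 0"
  shows "(\<forall>\<psi>\<in>states. \<psi> \<noteq> psi_plus \<longrightarrow>
            (transition \<alpha> \<beta> \<psi> extreme_point_of UCP \<longleftrightarrow> pure_state \<psi>))
       \<and> (\<not> transition \<alpha> \<beta> psi_plus extreme_point_of UCP \<longleftrightarrow>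
            (\<exists>c::complex. c \<noteq> 0 \<and>
              (adj shift * (diag (\<lambda>n. complex_of_real (\<alpha> n)))\<^sup>2 * shift = c *\<^sub>C 1 \<or>
               adj shift * (diag (\<lambda>n. complex_of_real (\<alpha> n)))\<^sup>2 * shift = c *\<^sub>C proj0)))"
proof -
  interpret coupled_sequences \<alpha> \<beta>
    using assms(3-5) by unfold_locales auto
  show ?thesis
    using pure_imp_extreme not_pure_imp_not_extreme psi_plus_extreme_iff by blast
qed

end
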